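(* For any continuous bilinear form $u\colon\mathcal{S}\times\mathcal{S}\to\mathbb{C}$ and any $n\in\mathbb{N}$, there are $(2n+1)$-states $\phi_1,\phi_2,\psi_1,\psi_2$ on $\mathcal{S}$ such that \[|u(x,y)|\leqslant K\|u\|_n^*\big(\phi_1(x^*x)+\phi_2(xx^* )\big)^{1/2}\big(\psi_1(y^*y)+\psi_2(yy^* )\big)^{1/2}\] for all $x,y\in\mathcal{S}$.
   Context: Let $\mathbb{N}=\{1,2,\dots\}$. Let $s$ be the space of complex sequences $\xi=(\xi_j)_{j\geqslant1}$ with $|\xi|_n:=(\sum_{j}|\xi_j|^2j^{2n})^{1/2}<\infty$ for all $n\in\mathbb{N}$, and let $s'$ be its dual, the space of sequences $\eta$ with $|\eta|_n':=(\sum_j|\eta_j|^2j^{-2n})^{1/2}<\infty$ for some $n$, with pairing $\langle\xi,\eta\rangle=\sum_j\xi_j\overline{\eta_j}$. The noncommutative Schwartz space $\mathcal{S}=L(s',s)$ is the Fréchet space of continuous linear operators $s'\to s$ with the topology of uniform convergence on bounded sets; it is a $*$-algebra with product $xy:=x\circ\iota\circ y$ ($\iota\colon s\hookrightarrow s'$ the inclusion) and involution given by $\langle x^*\xi,\eta\rangle=\langle\xi,x\eta\rangle$; $\mathcal{S}'$ is its dual. For $n\in\mathbb{N}$, $\|x\|_n:=\sup\{|x\xi|_n\colon \xi\in s',\ |\xi|_n'\leqslant1\}$, and $\|u\|_n^*:=\sup\{|u(x,y)|\colon\|x\|_n\leqslant1,\|y\|_n\leqslant1\}$. For $x_1,\dots,x_m\in\mathcal{S}$,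 $\|(x_j)\|_k^{rc}:=\max\{\|\sum_jx_j^*x_j\|_k^{1/2},\|\sum_jx_jx_j^*\|_k^{1/2}\}$. For $\xi\in s'$ with $|\xi|_n'\leqslant1$ let $\phi_\xi\in\mathcal{S}'$, $\phi_\xi(x)=\langle x\xi,\xi\rangle$; an $n$-state on $\mathcal{S}$ is an element of the closed convex hull in $\mathcal{S}'$ of $\{\phi_\xi\colon \xi\in s',|\xi|_n'\leqslant1\}$. For $n\in\mathbb{N}$, $K_n$ denotes the smallest constant such that $|\sum_{j=1}^mu(x_j,y_j)|\leqslant K_n\|u\|_n^*\|(x_j)\|_{2n+1}^{rc}\|(y_j)\|_{2n+1}^{rc}$ for all continuous bilinear forms $u$ on $\mathcal{S}\times\mathcal{S}$, all $m$ and all $x_j,y_j\in\mathcal{S}$; and $K:=\sup_nK_n$ (which satisfies $K\leqslant\pi^2/6$). *)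

theory Defs
  imports "HOL-Analysis.Analysis"
begin

text \<open>Sequences xi = (xi_j)_{j>=1} are represented as functions nat => complex,
  with index j of the paper corresponding to argument j - 1 (weight j = real (i+1)).\<close>

type_synonym seq = "nat \<Rightarrow> complex"
type_synonym op = "seq \<Rightarrow> seq"

definition sspace :: "seq set" where
  "sspace = {\<xi>. \<forall>n::nat. summable (\<lambda>i. (cmod (\<xi> i))\<^sup>2 * real (Suc i) ^ (2*n))}"

definition sdual :: "seq set" where
  "sdual = {\<eta>. \<exists>n::nat. summable (\<lambda>i. (cmod (\<eta> i))\<^sup>2 / real (Suc i) ^ (2*n))}"

definition snorm :: "nat \<Rightarrow> seq \<Rightarrow> real" where
  "snorm n \<xi> = sqrt (\<Sum>i. (cmod (\<xi> i))\<^sup>2 * real (Suc i) ^ (2*n))"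

definition sdnorm :: "nat \<Rightarrow> seq \<Rightarrow> real" where
  "sdnorm n \<eta> = sqrt (\<Sum>i. (cmod (\<eta> i))\<^sup>2 / real (Suc i) ^ (2*n))"

definition dball :: "nat \<Rightarrow> seq set" where
  "dball n = {\<eta>. summable (\<lambda>i. (cmod (\<eta> i))\<^sup>2 / real (Suc i) ^ (2*n)) \<and> sdnorm n \<eta> \<le> 1}"

definition pairing :: "seq \<Rightarrow> seq \<Rightarrow> complex" where
  "pairing \<xi> \<eta> = (\<Sum>i. \<xi> i * cnj (\<eta> i))"

text \<open>The noncommutative Schwartz space S = L(s',s): linear maps s' -> s
  (extended by 0 outside s'), continuous, i.e. bounded from (s',|.|'_n) to (s,|.|_n)
  for every n (equivalently, for every m,n from (s',|.|'_m) to (s,|.|_n)).\<close>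
definition Sspace :: "op set" where
  "Sspace = {x. (\<forall>\<xi>\<in>sdual. \<forall>\<eta>\<in>sdual. \<forall>a b::complex.
                    x (\<lambda>i. a * \<xi> i + b * \<eta> i) = (\<lambda>i. a * x \<xi> i + b * x \<eta> i))
              \<and> (\<forall>\<xi>\<in>sdual. x \<xi> \<in> sspace)
              \<and> (\<forall>\<xi>. \<xi> \<notin> sdual \<longrightarrow> x \<xi> = (\<lambda>i. 0))
              \<and> (\<forall>n. bdd_above (snorm n ` x ` dball n))}"

definition opnorm :: "nat \<Rightarrow> op \<Rightarrow> real" where
  "opnorm n x = (SUP \<xi>\<in>dball n. snorm n (x \<xi>))"

definition opmult :: "op \<Rightarrow> op \<Rightarrow> op" where
  "opmult x y = (\<lambda>\<xi>. x (y \<xi>))"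

definition adj :: "op \<Rightarrow> op" where
  "adj x = (THE y. y \<in> Sspace \<and>
              (\<forall>\<xi>\<in>sdual. \<forall>\<eta>\<in>sdual. pairing (y \<xi>) \<eta> = pairing \<xi> (x \<eta>)))"

definition opsum :: "nat \<Rightarrow> (nat \<Rightarrow> op) \<Rightarrow> op" where
  "opsum m xs = (\<lambda>\<xi> i. \<Sum>j<m. xs j \<xi> i)"

definition contbil :: "(op \<Rightarrow> op \<Rightarrow> complex) \<Rightarrow> bool" where
  "contbil u \<longleftrightarrow>
     (\<forall>x\<in>Sspace. \<forall>x'\<in>Sspace. \<forall>y\<in>Sspace. \<forall>a b::complex.
        u (\<lambda>\<xi> i. a * x \<xi> i + b * x' \<xi> i) y = a * u x y + b * u x' y
      \<and> u y (\<lambda>\<xi> i. a * x \<xi> i + b * x' \<xi> i) = a * u y x + b * u y x')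
   \<and> (\<exists>n C. \<forall>x\<in>Sspace. \<forall>y\<in>Sspace. cmod (u x y) \<le> C * opnorm n x * opnorm n y)"

definition bilnorm :: "nat \<Rightarrow> (op \<Rightarrow> op \<Rightarrow> complex) \<Rightarrow> ereal" where
  "bilnorm n u = (SUP (x,y)\<in>{(x,y). x \<in> Sspace \<and> y \<in> Sspace \<and> opnorm n x \<le> 1 \<and> opnorm n y \<le> 1}.
                     ereal (cmod (u x y)))"

definition rcnorm :: "nat \<Rightarrow> nat \<Rightarrow> (nat \<Rightarrow> op) \<Rightarrow> real" where
  "rcnorm k m xs = max (sqrt (opnorm k (opsum m (\<lambda>j. opmult (adj (xs j)) (xs j)))))
                        (sqrt (opnorm k (opsum m (\<lambda>j. opmult (xs j) (adj (xs j))))))"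

definition Sdual :: "(op \<Rightarrow> complex) set" where
  "Sdual = {\<phi>. (\<forall>x\<in>Sspace. \<forall>y\<in>Sspace. \<forall>a b::complex.
                   \<phi> (\<lambda>\<xi> i. a * x \<xi> i + b * y \<xi> i) = a * \<phi> x + b * \<phi> y)
             \<and> (\<exists>n C. \<forall>x\<in>Sspace. cmod (\<phi> x) \<le> C * opnorm n x)}"

definition vstate :: "seq \<Rightarrow> op \<Rightarrow> complex" where
  "vstate \<xi> x = pairing (x \<xi>) \<xi>"

text \<open>n-states: elements of S' in the weak-* closure of the convex hull of
  {phi_xi : |xi|'_n <= 1} (for convex sets in the dual of the reflexive space S
  this coincides with the strong closure).\<close>
definition nstate :: "nat \<Rightarrow> (op \<Rightarrow> complex) \<Rightarrow> bool" where
  "nstate n \<phi> \<longleftrightarrow> \<phi> \<in> Sdual \<and>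
     (\<forall>F \<epsilon>. finite F \<and> F \<subseteq> Sspace \<and> \<epsilon> > 0 \<longrightarrow>
        (\<exists>k (t::nat \<Rightarrow> real) (\<xi>::nat \<Rightarrow> seq).
            (\<forall>i<k. t i \<ge> 0 \<and> \<xi> i \<in> dball n) \<and> (\<Sum>i<k. t i) = 1 \<and>
            (\<forall>x\<in>F. cmod (\<phi> x - (\<Sum>i<k. complex_of_real (t i) * vstate (\<xi> i) x)) < \<epsilon>)))"

definition Kn :: "nat \<Rightarrow> ereal" where
  "Kn n = Inf {C. C \<ge> 0 \<and>
      (\<forall>u m xs ys. contbil u \<and> (\<forall>j<m. xs j \<in> Sspace \<and> ys j \<in> Sspace) \<longrightarrow>
          ereal (cmod (\<Sum>j<m. u (xs j) (ys j)))
            \<le> C * bilnorm n u * ereal (rcnorm (2*n+1) m xs) * ereal (rcnorm (2*n+1) m ys))}"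

definition Kconst :: ereal where
  "Kconst = (SUP n\<in>{1..}. Kn n)"

end

theory Submission
  imports Defs
begin

text \<open>
  If \<open>K\<close> times the norm of \<open>u\<close> is a positive real \<open>C\<close>, applying the defining inequality of \<open>K\<close> to
  rescaled and rotated families bounds every convex combination of the numbers \<open>|u(x,y)|\<close> by
  \<open>C/2 (||(x_j)||^2 + ||(y_j)||^2)\<close>. As \<open>||A||_k\<close> of a positive \<open>A\<close> is the supremum of \<open>\<langle>A\<xi>,\<xi>\<rangle>\<close>
  over the unit ball of \<open>|.|'_k\<close>, this is at most the supremum over quadruples of states of the
  corresponding combination of \<open>C/2 (\<phi>1(x* x) + \<phi>2(x x*) + \<psi>1(y* y) + \<psi>2(y y*))\<close>. The set of
  states is convex and compact, so a minimax theorem gives one quadruple that works for all \<open>(x,y)\<close>;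
  replacing \<open>(x,y)\<close> by \<open>(s x, y/s)\<close> and optimising over \<open>s\<close> gives the product form.
  If instead the extended real \<open>K ||u||_n\<close> is infinite, any
  state that is faithful, i.e. strictly positive on \<open>x* x\<close> for all \<open>x \<noteq> 0\<close>, makes the right-hand side
  infinite for nonzero \<open>x, y\<close>. This case includes \<open>||u||_n = \<infinity>\<close>, where \<open>K > 0\<close> is used because
  \<open>0 * \<infinity> = 0\<close>.
\<close>

section \<open>Sequence spaces\<close>

text \<open>The passage from the product to the sum is dictated by the minimax step: a product of
  two square roots is not affine in the states, whereas half the sum is affine in the whole
  quadruple, so multipliers for a finite family turn it into a weighted average. For one such
  average four vector states are enough; a quadruple valid for all pairs at once is a limit of
  mixtures, which is why the closed convex hull appears.

  Everything rests on one duality. \<open>snorm k\<close> and \<open>sdnorm k\<close> are weighted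
  l2 norms with reciprocal weights, so \<open>pairing\<close> makes them dual to each other with
  explicit extremal vectors. This bounds the adjoint, whose existence has to be established because
  \<open>adj\<close> is a definite description, and it turns the norm of a positive operator into
  the supremum of its quadratic form.

  Infinite values of \<open>bilnorm n u\<close> do occur: continuity of \<open>u\<close> refers to
  some index, which may be larger than the given \<open>n\<close>.\<close>

lemma cmod_add_power2_le: "(cmod (z + w))\<^sup>2 \<le> 2 * (cmod z)\<^sup>2 + 2 * (cmod w)\<^sup>2"
proof -
  have "(cmod (z + w))\<^sup>2 \<le> (cmod z + cmod w)\<^sup>2"
    by (simp add: norm_triangle_ineq power_mono)
  also have "\<dots> \<le> 2 * (cmod z)\<^sup>2 + 2 * (cmod w)\<^sup>2"
    using sum_squares_bound[of "cmod z" "cmod w"] by (simp add: power2_sum)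
  finally show ?thesis .
qed

text \<open>The weight is left arbitrary so as to serve both the growing weights of s and the
  decaying weights of s'.\<close>

lemma weighted_square_summable_add:
  fixes a b :: seq
  assumes "summable (\<lambda>i. (cmod (a i))\<^sup>2 * w i)" "summable (\<lambda>i. (cmod (b i))\<^sup>2 * w i)"
    and "\<And>i. w i \<ge> 0"
  shows "summable (\<lambda>i. (cmod (a i + b i))\<^sup>2 * w i)"
proof (rule summable_comparison_test')
  show "summable (\<lambda>i. 2 * ((cmod (a i))\<^sup>2 * w i) + 2 * ((cmod (b i))\<^sup>2 * w i))"
    by (intro summable_add summable_mult assms)
  fix i
  show "norm ((cmod (a i + b i))\<^sup>2 * w i) \<le> 2 * ((cmod (a i))\<^sup>2 * w i) + 2 * ((cmod (b i))\<^sup>2 * w i)"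
    using mult_right_mono[OF cmod_add_power2_le[of "a i" "b i"] assms(3)[of i]] assms(3)[of i]
    by (simp add: distrib_right mult.assoc)
qed

text \<open>One step of the inductive limit s'. Membership has to be carried along, since
  \<open>sdnorm n\<close> says nothing about a sequence whose series diverges.\<close>

definition sdualn :: "nat \<Rightarrow> seq set" where
  "sdualn n = {\<eta>. summable (\<lambda>i. (cmod (\<eta> i))\<^sup>2 / real (Suc i) ^ (2*n))}"

lemma sdualD: "\<eta> \<in> sdual \<Longrightarrow> \<exists>n. \<eta> \<in> sdualn n"
  by (simp add: sdual_def sdualn_def)

lemma sdualn_subset_sdual: "sdualn n \<subseteq> sdual"
  by (auto simp: sdual_def sdualn_def)

lemma dball_alt: "\<eta> \<in> dball n \<longleftrightarrow> \<eta> \<in> sdualn n \<and> sdnorm n \<eta> \<le> 1"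
  by (simp add: dball_def sdualn_def)

lemma dball_subset_sdual: "dball n \<subseteq> sdual"
  using sdualn_subset_sdual dball_alt by blast

lemma sdualn_mono:
  assumes "m \<le> n"
  shows "sdualn m \<subseteq> sdualn n"
proof
  fix \<eta> assume "\<eta> \<in> sdualn m"
  then have s: "summable (\<lambda>i. (cmod (\<eta> i))\<^sup>2 / real (Suc i) ^ (2*m))" by (simp add: sdualn_def)
  have "summable (\<lambda>i. (cmod (\<eta> i))\<^sup>2 / real (Suc i) ^ (2*n))"
  proof (rule summable_comparison_test'[OF s])
    fix i
    have "real (Suc i) ^ (2*m) \<le> real (Suc i) ^ (2*n)" using assms by (intro power_increasing) auto
    then show "norm ((cmod (\<eta> i))\<^sup>2 / real (Suc i) ^ (2*n)) \<le> (cmod (\<eta> i))\<^sup>2 / real (Suc i) ^ (2*m)"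
      by (auto intro!: divide_left_mono mult_pos_pos simp del: of_nat_Suc)
  qed
  then show "\<eta> \<in> sdualn n" by (simp add: sdualn_def)
qed

lemma sdualn_add: "\<xi> \<in> sdualn n \<Longrightarrow> \<eta> \<in> sdualn n \<Longrightarrow> (\<lambda>i. \<xi> i + \<eta> i) \<in> sdualn n"
  using weighted_square_summable_add[of \<xi> "\<lambda>i. 1 / real (Suc i) ^ (2*n)" \<eta>]
  by (simp add: sdualn_def)

lemma sdualn_scale: "\<xi> \<in> sdualn n \<Longrightarrow> (\<lambda>i. a * \<xi> i) \<in> sdualn n"
  unfolding sdualn_def mem_Collect_eq norm_mult power_mult_distrib times_divide_eq_right[symmetric]
  by (rule summable_mult)

lemma sdnorm_scale: "\<xi> \<in> sdualn n \<Longrightarrow> sdnorm n (\<lambda>i. a * \<xi> i) = cmod a * sdnorm n \<xi>"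
  unfolding sdnorm_def sdualn_def mem_Collect_eq norm_mult power_mult_distrib times_divide_eq_right[symmetric]
  by (subst suminf_mult) (simp_all add: real_sqrt_mult)

lemma sdual_lincomb:
  assumes "\<xi> \<in> sdual" "\<eta> \<in> sdual"
  shows "(\<lambda>i. a * \<xi> i + b * \<eta> i) \<in> sdual"
proof -
  obtain m n where "\<xi> \<in> sdualn m" "\<eta> \<in> sdualn n" using assms sdualD by blast
  then have "\<xi> \<in> sdualn (max m n)" "\<eta> \<in> sdualn (max m n)"
    using sdualn_mono[of m "max m n"] sdualn_mono[of n "max m n"] by auto
  then show ?thesis using sdualn_add sdualn_scale sdualn_subset_sdual by blast
qed

lemma sspace_add: "\<xi> \<in> sspace \<Longrightarrow> \<eta> \<in> sspace \<Longrightarrow> (\<lambda>i. \<xi> i + \<eta> i) \<in> sspace"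
  using weighted_square_summable_add[of \<xi> "\<lambda>i. real (Suc i) ^ (2*n)" \<eta> for n]
  by (simp add: sspace_def)

lemma sspace_scale: "\<xi> \<in> sspace \<Longrightarrow> (\<lambda>i. a * \<xi> i) \<in> sspace"
  unfolding sspace_def mem_Collect_eq norm_mult power_mult_distrib mult.assoc
  by (auto intro: summable_mult)

lemma sspace_lincomb: "\<xi> \<in> sspace \<Longrightarrow> \<eta> \<in> sspace \<Longrightarrow> (\<lambda>i. a * \<xi> i + b * \<eta> i) \<in> sspace"
  by (intro sspace_add sspace_scale)

lemma snorm_scale: "\<xi> \<in> sspace \<Longrightarrow> snorm n (\<lambda>i. a * \<xi> i) = cmod a * snorm n \<xi>"
  unfolding snorm_def sspace_def mem_Collect_eq norm_mult power_mult_distrib mult.assoc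
  by (subst suminf_mult) (simp_all add: real_sqrt_mult)

lemma snorm_nonneg: "\<xi> \<in> sspace \<Longrightarrow> snorm n \<xi> \<ge> 0"
  unfolding snorm_def sspace_def by (auto intro!: suminf_nonneg)

lemma sdnorm_nonneg: "\<xi> \<in> sdualn n \<Longrightarrow> sdnorm n \<xi> \<ge> 0"
  unfolding sdnorm_def sdualn_def by (auto intro!: suminf_nonneg)

text \<open>Moving \<open>sqrt (w i)\<close> from one factor to the other reduces each partial sum
  to the finite Cauchy-Schwarz inequality; the uniform bound on partial sums gives both
  claims.\<close>

lemma weighted_Cauchy_Schwarz:
  fixes f g w :: "nat \<Rightarrow> real"
  assumes f: "summable (\<lambda>i. (f i)\<^sup>2 * w i)" and g: "summable (\<lambda>i. (g i)\<^sup>2 / w i)"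
    and w: "\<And>i. w i > 0"
  shows "summable (\<lambda>i. \<bar>f i * g i\<bar>)"
    and "(\<Sum>i. \<bar>f i * g i\<bar>) \<le> sqrt (\<Sum>i. (f i)\<^sup>2 * w i) * sqrt (\<Sum>i. (g i)\<^sup>2 / w i)"
proof -
  have partial: "(\<Sum>i<N. \<bar>f i * g i\<bar>) \<le> sqrt (\<Sum>i. (f i)\<^sup>2 * w i) * sqrt (\<Sum>i. (g i)\<^sup>2 / w i)" for N
  proof -
    have "(\<Sum>i<N. \<bar>f i * g i\<bar>) = (\<Sum>i<N. \<bar>f i * sqrt (w i)\<bar> * \<bar>g i / sqrt (w i)\<bar>)"
      using w by (intro sum.cong refl) (simp add: abs_mult less_imp_neq[symmetric])
    also have "\<dots> \<le> L2_set (\<lambda>i. f i * sqrt (w i)) {..<N} * L2_set (\<lambda>i. g i / sqrt (w i)) {..<N}"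
      by (rule L2_set_mult_ineq)
    also have "\<dots> = sqrt (\<Sum>i<N. (f i)\<^sup>2 * w i) * sqrt (\<Sum>i<N. (g i)\<^sup>2 / w i)"
      unfolding L2_set_def using w by (simp add: power_mult_distrib power_divide less_imp_le)
    also have "\<dots> \<le> sqrt (\<Sum>i. (f i)\<^sup>2 * w i) * sqrt (\<Sum>i. (g i)\<^sup>2 / w i)"
      using w by (intro mult_mono real_sqrt_le_mono sum_le_suminf f g)
        (auto intro!: sum_nonneg suminf_nonneg f g simp: less_imp_le)
    finally show ?thesis .
  qed
  show s: "summable (\<lambda>i. \<bar>f i * g i\<bar>)"
    by (rule bounded_imp_summable[where B="sqrt (\<Sum>i. (f i)\<^sup>2 * w i) * sqrt (\<Sum>i. (g i)\<^sup>2 / w i)"])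
      (use partial[of "Suc _"] in \<open>auto simp: lessThan_Suc_atMost\<close>)
  show "(\<Sum>i. \<bar>f i * g i\<bar>) \<le> sqrt (\<Sum>i. (f i)\<^sup>2 * w i) * sqrt (\<Sum>i. (g i)\<^sup>2 / w i)"
    by (rule suminf_le_const[OF s partial])
qed

lemma pairing_abs_summable:
  assumes "\<zeta> \<in> sspace" "\<eta> \<in> sdualn n"
  shows "summable (\<lambda>i. cmod (\<zeta> i * cnj (\<eta> i)))"
    and "(\<Sum>i. cmod (\<zeta> i * cnj (\<eta> i))) \<le> snorm n \<zeta> * sdnorm n \<eta>"
  using weighted_Cauchy_Schwarz[of "\<lambda>i. cmod (\<zeta> i)" "\<lambda>i. real (Suc i) ^ (2*n)" "\<lambda>i. cmod (\<eta> i)"] assms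
  by (simp_all add: sspace_def sdualn_def norm_mult snorm_def sdnorm_def)

lemma pairing_bound:
  assumes "\<zeta> \<in> sspace" "\<eta> \<in> sdualn n"
  shows "cmod (pairing \<zeta> \<eta>) \<le> snorm n \<zeta> * sdnorm n \<eta>"
  unfolding pairing_def
  using summable_norm[OF pairing_abs_summable(1)[OF assms]] pairing_abs_summable(2)[OF assms] by linarith

lemma pairing_sums:
  assumes "\<zeta> \<in> sspace" "\<eta> \<in> sdual"
  shows "(\<lambda>i. \<zeta> i * cnj (\<eta> i)) sums pairing \<zeta> \<eta>"
proof -
  obtain n where "\<eta> \<in> sdualn n" using sdualD[OF assms(2)] by blast
  from pairing_abs_summable(1)[OF assms(1) this] show ?thesis
    unfolding pairing_def by (intro summable_sums) (rule summable_norm_cancel)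
qed

text \<open>The equation defining \<open>adj\<close> also pairs an element of s' with one of s in
  this order; convergence then comes from conjugation.\<close>

lemma pairing_sums':
  assumes "\<eta> \<in> sdual" "\<zeta> \<in> sspace"
  shows "(\<lambda>i. \<eta> i * cnj (\<zeta> i)) sums cnj (pairing \<zeta> \<eta>)"
  using pairing_sums[OF assms(2,1)] by (subst sums_cnj[symmetric]) (simp add: mult.commute)

lemma pairing_cnj:
  assumes "\<eta> \<in> sdual" "\<zeta> \<in> sspace"
  shows "pairing \<eta> \<zeta> = cnj (pairing \<zeta> \<eta>)"
  unfolding pairing_def[of \<eta>] by (rule sums_unique[OF pairing_sums'[OF assms], symmetric])

lemma pairing_lincomb_left:
  assumes "\<zeta> \<in> sspace" "\<zeta>' \<in> sspace" "\<eta> \<in> sdual"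
  shows "pairing (\<lambda>i. a * \<zeta> i + b * \<zeta>' i) \<eta> = a * pairing \<zeta> \<eta> + b * pairing \<zeta>' \<eta>"
proof -
  have "(\<lambda>i. a * (\<zeta> i * cnj (\<eta> i)) + b * (\<zeta>' i * cnj (\<eta> i))) sums (a * pairing \<zeta> \<eta> + b * pairing \<zeta>' \<eta>)"
    by (intro sums_add sums_mult pairing_sums assms)
  then show ?thesis
    unfolding pairing_def[of "\<lambda>i. a * \<zeta> i + b * \<zeta>' i"] by (intro sums_unique[symmetric]) (simp add: algebra_simps)
qed

lemma pairing_lincomb_left':
  assumes "\<eta> \<in> sdual" "\<eta>' \<in> sdual" "\<zeta> \<in> sspace"
  shows "pairing (\<lambda>i. a * \<eta> i + b * \<eta>' i) \<zeta> = a * pairing \<eta> \<zeta> + b * pairing \<eta>' \<zeta>"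
proof -
  have "(\<lambda>i. a * (\<eta> i * cnj (\<zeta> i)) + b * (\<eta>' i * cnj (\<zeta> i))) sums (a * pairing \<eta> \<zeta> + b * pairing \<eta>' \<zeta>)"
    using assms by (intro sums_add sums_mult) (simp_all add: pairing_cnj pairing_sums')
  then show ?thesis
    unfolding pairing_def[of "\<lambda>i. a * \<eta> i + b * \<eta>' i"] by (intro sums_unique[symmetric]) (simp add: algebra_simps)
qed

lemma sspace_subset_sdualn: "sspace \<subseteq> sdualn n"
proof
  fix \<zeta> assume "\<zeta> \<in> sspace"
  then have "\<forall>n. summable (\<lambda>i. (cmod (\<zeta> i))\<^sup>2 * real (Suc i) ^ (2*n))" by (simp add: sspace_def)
  from spec[OF this, of 0] have s: "summable (\<lambda>i. (cmod (\<zeta> i))\<^sup>2)" by simp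
  have "(cmod (\<zeta> i))\<^sup>2 / real (Suc i) ^ (2*n) \<le> (cmod (\<zeta> i))\<^sup>2 / 1" for i
    by (intro divide_left_mono) (auto simp del: of_nat_Suc)
  then have "summable (\<lambda>i. (cmod (\<zeta> i))\<^sup>2 / real (Suc i) ^ (2*n))"
    by (intro summable_comparison_test'[OF s]) auto
  then show "\<zeta> \<in> sdualn n" by (simp add: sdualn_def)
qed

lemma sspace_subset_sdual: "sspace \<subseteq> sdual"
  using sspace_subset_sdualn[of 0] sdualn_subset_sdual[of 0] by blast

text \<open>All weights are at least one. Hence the inclusion of s into s', which is hidden in every
  product of operators, does not increase norms, and \<open>opmult_in_Sspace\<close> gets its
  bound.\<close>

lemma sdnorm_le_snorm:
  assumes "\<zeta> \<in> sspace"
  shows "sdnorm n \<zeta> \<le> snorm n \<zeta>"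
  unfolding sdnorm_def snorm_def
proof (intro real_sqrt_le_mono suminf_le)
  show "summable (\<lambda>i. (cmod (\<zeta> i))\<^sup>2 / real (Suc i) ^ (2*n))"
    using sspace_subset_sdualn assms by (auto simp: sdualn_def)
  show "summable (\<lambda>i. (cmod (\<zeta> i))\<^sup>2 * real (Suc i) ^ (2*n))"
    using assms by (simp add: sspace_def)
  fix i
  have "(1::real) \<le> real (Suc i) ^ (2*n)" by (simp del: of_nat_Suc)
  then have "(cmod (\<zeta> i))\<^sup>2 / real (Suc i) ^ (2*n) \<le> (cmod (\<zeta> i))\<^sup>2 / 1"
    "(cmod (\<zeta> i))\<^sup>2 * 1 \<le> (cmod (\<zeta> i))\<^sup>2 * real (Suc i) ^ (2*n)"
    by (intro divide_left_mono mult_left_mono; simp del: of_nat_Suc)+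
  then show "(cmod (\<zeta> i))\<^sup>2 / real (Suc i) ^ (2*n) \<le> (cmod (\<zeta> i))\<^sup>2 * real (Suc i) ^ (2*n)" by linarith
qed

lemma zero_in_sspace: "(\<lambda>i. 0) \<in> sspace"
  by (simp add: sspace_def)

lemma zero_in_dball: "(\<lambda>i. 0) \<in> dball n"
  by (simp add: dball_def sdnorm_def)

lemma zero_in_sdual: "(\<lambda>i. 0) \<in> sdual"
  using zero_in_dball dball_subset_sdual by blast

section \<open>Operators from s' to s and their norms\<close>

lemma
  assumes "x \<in> Sspace"
  shows Sspace_lincomb: "\<And>\<xi> \<eta> a b. \<xi> \<in> sdual \<Longrightarrow> \<eta> \<in> sdual \<Longrightarrow>
      x (\<lambda>i. a * \<xi> i + b * \<eta> i) = (\<lambda>i. a * x \<xi> i + b * x \<eta> i)"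
    and Sspace_outside: "\<And>\<xi>. \<xi> \<notin> sdual \<Longrightarrow> x \<xi> = (\<lambda>i. 0)"
    and Sspace_bdd: "\<And>n. bdd_above (snorm n ` x ` dball n)"
  using assms by (simp_all add: Sspace_def)

lemma Sspace_sspace: "x \<in> Sspace \<Longrightarrow> x \<xi> \<in> sspace"
  using zero_in_sspace unfolding Sspace_def by (cases "\<xi> \<in> sdual") auto

lemma Sspace_zero:
  assumes "x \<in> Sspace"
  shows "x (\<lambda>i. 0) = (\<lambda>i. 0)"
  using Sspace_lincomb[OF assms zero_in_sdual zero_in_sdual, of 0 0] by simp

lemma Sspace_scale:
  assumes "x \<in> Sspace" "\<xi> \<in> sdual"
  shows "x (\<lambda>i. a * \<xi> i) = (\<lambda>i. a * x \<xi> i)"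
  using Sspace_lincomb[OF assms(1) assms(2) assms(2), of a 0] by simp

lemma opnorm_upper: "x \<in> Sspace \<Longrightarrow> \<xi> \<in> dball n \<Longrightarrow> snorm n (x \<xi>) \<le> opnorm n x"
  unfolding opnorm_def using Sspace_bdd[of x n] by (auto intro: cSUP_upper simp: image_image)

lemma opnorm_least: "(\<And>\<xi>. \<xi> \<in> dball n \<Longrightarrow> snorm n (x \<xi>) \<le> c) \<Longrightarrow> opnorm n x \<le> c"
  unfolding opnorm_def using zero_in_dball by (intro cSUP_least) auto

lemma opnorm_nonneg: "x \<in> Sspace \<Longrightarrow> opnorm n x \<ge> 0"
  using opnorm_upper[OF _ zero_in_dball] snorm_nonneg[OF Sspace_sspace] order_trans by blast

lemma opnorm_bound:
  assumes x: "x \<in> Sspace" and \<xi>: "\<xi> \<in> sdualn n"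
  shows "snorm n (x \<xi>) \<le> opnorm n x * sdnorm n \<xi>"
proof (rule field_le_epsilon)
  fix e :: real assume "e > 0"
  \<comment> \<open>Normalising by a number slightly above the norm covers vectors of norm zero; the
    \<open>+ 1\<close> keeps the denominator positive and the final error below
    \<open>e\<close>.\<close>
  define d where "d = sdnorm n \<xi> + e / (opnorm n x + 1)"
  have o: "opnorm n x \<ge> 0" by (rule opnorm_nonneg[OF x])
  have s: "sdnorm n \<xi> \<ge> 0" by (rule sdnorm_nonneg[OF \<xi>])
  have d: "d > 0" "sdnorm n \<xi> \<le> d" 
    unfolding d_def using \<open>e > 0\<close> o s by (simp_all add: add_nonneg_pos)
  have "sdnorm n (\<lambda>i. complex_of_real (1 / d) * \<xi> i) = sdnorm n \<xi> / d"
    unfolding sdnorm_scale[OF \<xi>] norm_of_real using d by simp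
  then have "(\<lambda>i. complex_of_real (1 / d) * \<xi> i) \<in> dball n"
    unfolding dball_alt using d sdualn_scale[OF \<xi>, of "complex_of_real (1 / d)"] by simp
  then have "snorm n (x (\<lambda>i. complex_of_real (1 / d) * \<xi> i)) \<le> opnorm n x"
    by (rule opnorm_upper[OF x])
  moreover have "\<xi> \<in> sdual" using \<xi> sdualn_subset_sdual by blast
  ultimately have "snorm n (x \<xi>) / d \<le> opnorm n x"
    using d unfolding Sspace_scale[OF x \<open>\<xi> \<in> sdual\<close>] snorm_scale[OF Sspace_sspace[OF x]] norm_of_real by simp
  then have "snorm n (x \<xi>) \<le> opnorm n x * d" using d by (simp add: pos_divide_le_eq)
  also have "\<dots> \<le> opnorm n x * sdnorm n \<xi> + e"
  proof -
    have "opnorm n x / (opnorm n x + 1) \<le> 1" using o by simp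
    from mult_right_mono[OF this, of e] show ?thesis using \<open>e > 0\<close> by (simp add: d_def distrib_left)
  qed
  finally show "snorm n (x \<xi>) \<le> opnorm n x * sdnorm n \<xi> + e" .
qed

section \<open>Operators and adjoints\<close>

lemma SspaceI:
  assumes "\<And>\<xi> \<eta> a b. \<xi> \<in> sdual \<Longrightarrow> \<eta> \<in> sdual \<Longrightarrow>
      x (\<lambda>i. a * \<xi> i + b * \<eta> i) = (\<lambda>i. a * x \<xi> i + b * x \<eta> i)"
    and "\<And>\<xi>. \<xi> \<in> sdual \<Longrightarrow> x \<xi> \<in> sspace"
    and "\<And>\<xi>. \<xi> \<notin> sdual \<Longrightarrow> x \<xi> = (\<lambda>i. 0)"
    and "\<And>n \<xi>. \<xi> \<in> dball n \<Longrightarrow> snorm n (x \<xi>) \<le> c n"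
  shows "x \<in> Sspace"
proof -
  have "bdd_above (snorm n ` x ` dball n)" for n
    using assms(4) by (intro bdd_aboveI[where M="c n"]) auto
  then show ?thesis unfolding Sspace_def using assms(1-3) by simp
qed

text \<open>A triangle inequality up to a constant is enough for the boundedness of linear
  combinations of operators.\<close>

lemma snorm_add_power2:
  assumes "\<xi> \<in> sspace" "\<eta> \<in> sspace"
  shows "(snorm n (\<lambda>i. \<xi> i + \<eta> i))\<^sup>2 \<le> 2 * (snorm n \<xi>)\<^sup>2 + 2 * (snorm n \<eta>)\<^sup>2"
proof -
  let ?w = "\<lambda>i. real (Suc i) ^ (2*n)"
  have s: "summable (\<lambda>i. (cmod (\<zeta> i))\<^sup>2 * ?w i)" if "\<zeta> \<in> sspace" for \<zeta>
    using that by (simp add: sspace_def)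
  have sq: "(snorm n \<zeta>)\<^sup>2 = (\<Sum>i. (cmod (\<zeta> i))\<^sup>2 * ?w i)" if "\<zeta> \<in> sspace" for \<zeta>
    unfolding snorm_def using s[OF that] by (simp add: suminf_nonneg)
  have "(\<Sum>i. (cmod (\<xi> i + \<eta> i))\<^sup>2 * ?w i)
      \<le> (\<Sum>i. 2 * ((cmod (\<xi> i))\<^sup>2 * ?w i) + 2 * ((cmod (\<eta> i))\<^sup>2 * ?w i))"
  proof (rule suminf_le)
    show "summable (\<lambda>i. (cmod (\<xi> i + \<eta> i))\<^sup>2 * ?w i)"
      by (rule s[OF sspace_add[OF assms]])
    show "summable (\<lambda>i. 2 * ((cmod (\<xi> i))\<^sup>2 * ?w i) + 2 * ((cmod (\<eta> i))\<^sup>2 * ?w i))"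
      by (intro summable_add summable_mult s assms)
    fix i
    have "(cmod (\<xi> i + \<eta> i))\<^sup>2 * ?w i \<le> (2 * (cmod (\<xi> i))\<^sup>2 + 2 * (cmod (\<eta> i))\<^sup>2) * ?w i"
      by (intro mult_right_mono cmod_add_power2_le) simp
    then show "(cmod (\<xi> i + \<eta> i))\<^sup>2 * ?w i \<le> 2 * ((cmod (\<xi> i))\<^sup>2 * ?w i) + 2 * ((cmod (\<eta> i))\<^sup>2 * ?w i)"
      by (simp only: distrib_right mult.assoc)
  qed
  also have "\<dots> = 2 * (\<Sum>i. (cmod (\<xi> i))\<^sup>2 * ?w i) + 2 * (\<Sum>i. (cmod (\<eta> i))\<^sup>2 * ?w i)"
    unfolding suminf_mult[OF s[OF assms(1)], symmetric] suminf_mult[OF s[OF assms(2)], symmetric]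
    by (rule suminf_add[symmetric]) (intro summable_mult s assms)+
  finally show ?thesis by (simp only: sq sspace_add assms)
qed

lemma Sspace_lincomb_closed:
  assumes x: "x \<in> Sspace" and y: "y \<in> Sspace"
  shows "(\<lambda>\<xi> i. a * x \<xi> i + b * y \<xi> i) \<in> Sspace"
proof (rule SspaceI)
  fix n \<xi> assume \<xi>: "\<xi> \<in> dball n"
  have "(snorm n (\<lambda>i. a * x \<xi> i + b * y \<xi> i))\<^sup>2
      \<le> 2 * (snorm n (\<lambda>i. a * x \<xi> i))\<^sup>2 + 2 * (snorm n (\<lambda>i. b * y \<xi> i))\<^sup>2"
    by (intro snorm_add_power2 sspace_scale Sspace_sspace x y)
  also have "\<dots> \<le> 2 * (cmod a * opnorm n x)\<^sup>2 + 2 * (cmod b * opnorm n y)\<^sup>2"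
    unfolding snorm_scale[OF Sspace_sspace[OF x]] snorm_scale[OF Sspace_sspace[OF y]]
    using opnorm_upper[OF x \<xi>] opnorm_upper[OF y \<xi>] snorm_nonneg[OF Sspace_sspace[OF x]] snorm_nonneg[OF Sspace_sspace[OF y]]
    by (intro add_mono mult_left_mono power_mono mult_nonneg_nonneg) auto
  finally show "snorm n (\<lambda>i. a * x \<xi> i + b * y \<xi> i)
      \<le> sqrt (2 * (cmod a * opnorm n x)\<^sup>2 + 2 * (cmod b * opnorm n y)\<^sup>2)"
    by (rule real_le_rsqrt)
qed (simp_all add: Sspace_lincomb[OF x] Sspace_lincomb[OF y] Sspace_outside[OF x] Sspace_outside[OF y]
      sspace_lincomb Sspace_sspace[OF x] Sspace_sspace[OF y] algebra_simps)

lemma zero_in_Sspace: "(\<lambda>\<xi> i. 0) \<in> Sspace"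
  by (rule SspaceI[where c="\<lambda>_. 0"]) (auto simp: zero_in_sspace snorm_def)

lemma opnorm_zero: "opnorm n (\<lambda>\<xi> i. 0) = 0"
proof -
  have "dball n \<noteq> {}" using zero_in_dball by blast
  then show ?thesis by (simp add: opnorm_def snorm_def)
qed

lemma Sspace_scale_closed:
  assumes "x \<in> Sspace"
  shows "(\<lambda>\<xi> i. a * x \<xi> i) \<in> Sspace"
  using Sspace_lincomb_closed[OF assms assms, of a 0] by simp

lemma opnorm_scale_le:
  assumes "x \<in> Sspace"
  shows "opnorm n (\<lambda>\<xi> i. a * x \<xi> i) \<le> cmod a * opnorm n x"
  by (rule opnorm_least) (simp add: snorm_scale[OF Sspace_sspace[OF assms]] mult_left_mono opnorm_upper[OF assms])

lemma opsum_in_Sspace: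
  assumes "\<And>j. j < m \<Longrightarrow> xs j \<in> Sspace"
  shows "opsum m xs \<in> Sspace"
  using assms
proof (induction m)
  case 0
  then show ?case using zero_in_Sspace by (simp add: opsum_def)
next
  case (Suc m)
  then have "(\<lambda>\<xi> i. 1 * opsum m xs \<xi> i + 1 * xs m \<xi> i) \<in> Sspace"
    by (intro Sspace_lincomb_closed) auto
  then show ?case by (simp add: opsum_def)
qed

lemma opmult_in_Sspace:
  assumes x: "x \<in> Sspace" and y: "y \<in> Sspace"
  shows "opmult x y \<in> Sspace"
  unfolding opmult_def
proof (rule SspaceI)
  have d: "y \<xi> \<in> sdual" for \<xi> using Sspace_sspace[OF y] sspace_subset_sdual by blast
  show "x (y (\<lambda>i. a * \<xi> i + b * \<eta> i)) = (\<lambda>i. a * x (y \<xi>) i + b * x (y \<eta>) i)"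
    if "\<xi> \<in> sdual" "\<eta> \<in> sdual" for \<xi> \<eta> a b
    by (simp only: Sspace_lincomb[OF y that] Sspace_lincomb[OF x d d])
  fix n \<xi> assume \<xi>: "\<xi> \<in> dball n"
  have "snorm n (x (y \<xi>)) \<le> opnorm n x * sdnorm n (y \<xi>)"
    using Sspace_sspace[OF y] sspace_subset_sdualn by (blast intro: opnorm_bound[OF x])
  also have "\<dots> \<le> opnorm n x * opnorm n y"
    using sdnorm_le_snorm[OF Sspace_sspace[OF y]] opnorm_upper[OF y \<xi>] opnorm_nonneg[OF x]
    by (meson mult_left_mono order_trans)
  finally show "snorm n (x (y \<xi>)) \<le> opnorm n x * opnorm n y" .
qed (simp_all add: Sspace_sspace[OF x] Sspace_outside[OF y] Sspace_zero[OF x])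

section \<open>Truncations and the expansion of an operator in its columns\<close>

definition unitv :: "nat \<Rightarrow> seq" where
  "unitv i = (\<lambda>j. if j = i then 1 else 0)"

definition trunc :: "nat \<Rightarrow> seq \<Rightarrow> seq" where
  "trunc N \<eta> = (\<lambda>i. if i < N then \<eta> i else 0)"

lemma trunc_Suc: "trunc (Suc N) \<eta> = (\<lambda>i. 1 * trunc N \<eta> i + \<eta> N * unitv N i)"
  by (auto simp: trunc_def unitv_def less_Suc_eq)

lemma trunc_in_sspace: "trunc N \<eta> \<in> sspace"
  unfolding sspace_def by (auto intro!: summable_finite[of "{..<N}"] simp: trunc_def split: if_splits)

lemma unitv_in_sspace: "unitv i \<in> sspace"
  unfolding sspace_def by (auto intro!: summable_finite[of "{i}"] simp: unitv_def split: if_splits)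

lemma trunc_in_sdual: "trunc N \<eta> \<in> sdual" and unitv_in_sdual: "unitv i \<in> sdual"
  using trunc_in_sspace unitv_in_sspace sspace_subset_sdual by blast+

text \<open>The difference is written as a linear combination so that \<open>Sspace_lincomb\<close> applies to it.\<close>

lemma sdnorm_trunc_tendsto:
  assumes \<eta>: "\<eta> \<in> sdualn n"
  shows "(\<lambda>N. sdnorm n (\<lambda>i. 1 * \<eta> i + (-1) * trunc N \<eta> i)) \<longlonglongrightarrow> 0"
proof -
  define a where "a i = (cmod (\<eta> i))\<^sup>2 / real (Suc i) ^ (2*n)" for i
  have a: "summable a" using \<eta> unfolding sdualn_def a_def by simp
  have "(\<lambda>i. (cmod (1 * \<eta> i + (-1) * trunc N \<eta> i))\<^sup>2 / real (Suc i) ^ (2*n)) sums (suminf a - (\<Sum>i<N. a i))" for N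
  proof -
    have "(\<lambda>i. a i - (if i \<in> {..<N} then a i else 0)) sums (suminf a - (\<Sum>i<N. a i))"
      by (intro sums_diff summable_sums a sums_If_finite_set) simp
    moreover have "a i - (if i \<in> {..<N} then a i else 0)
        = (cmod (1 * \<eta> i + (-1) * trunc N \<eta> i))\<^sup>2 / real (Suc i) ^ (2*n)" for i
      by (simp add: a_def trunc_def)
    ultimately show ?thesis by simp
  qed
  from sums_unique[OF this, symmetric]
  have "(\<lambda>N. sdnorm n (\<lambda>i. 1 * \<eta> i + (-1) * trunc N \<eta> i)) = (\<lambda>N. sqrt (suminf a - (\<Sum>i<N. a i)))"
    unfolding sdnorm_def by (intro ext) (simp only:)
  moreover have "(\<lambda>N. sqrt (suminf a - (\<Sum>i<N. a i))) \<longlonglongrightarrow> sqrt (suminf a - suminf a)"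
    by (intro tendsto_intros summable_LIMSEQ a)
  ultimately show ?thesis by simp
qed

text \<open>Truncations converge in each step of s', and \<open>x\<close> is bounded from the n-th
  dual norm to the n-th norm. The index is taken large enough for both vectors to lie in the same
  step.\<close>

lemma pairing_op_trunc_tendsto:
  assumes x: "x \<in> Sspace" and \<xi>: "\<xi> \<in> sdual" and \<eta>: "\<eta> \<in> sdual"
  shows "(\<lambda>N. pairing (x (trunc N \<eta>)) \<xi>) \<longlonglongrightarrow> pairing (x \<eta>) \<xi>"
proof -
  obtain k l where "\<xi> \<in> sdualn k" "\<eta> \<in> sdualn l" using \<xi> \<eta> sdualD by blast
  define n where "n = max k l"
  have n: "\<xi> \<in> sdualn n" "\<eta> \<in> sdualn n"
    using \<open>\<xi> \<in> sdualn k\<close> \<open>\<eta> \<in> sdualn l\<close> sdualn_mono[of k n] sdualn_mono[of l n] by (auto simp: n_def)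
  define d where "d N = (\<lambda>i. 1 * \<eta> i + (-1) * trunc N \<eta> i)" for N
  have dn: "d N \<in> sdualn n" for N
    unfolding d_def
    by (rule sdualn_add[OF sdualn_scale[OF n(2)] sdualn_scale[OF subsetD[OF sspace_subset_sdualn trunc_in_sspace]]])
  have xd: "pairing (x \<eta>) \<xi> - pairing (x (trunc N \<eta>)) \<xi> = pairing (x (d N)) \<xi>" for N
    unfolding d_def Sspace_lincomb[OF x \<eta> trunc_in_sdual]
    by (subst pairing_lincomb_left) (simp_all add: Sspace_sspace[OF x] \<xi>)
  have le: "cmod (pairing (x \<eta>) \<xi> - pairing (x (trunc N \<eta>)) \<xi>) \<le> opnorm n x * sdnorm n (d N) * sdnorm n \<xi>" for N
    unfolding xd
    by (rule order_trans[OF pairing_bound[OF Sspace_sspace[OF x] n(1)]])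
      (intro mult_right_mono opnorm_bound[OF x dn] sdnorm_nonneg[OF n(1)])
  have "(\<lambda>N. opnorm n x * sdnorm n (d N) * sdnorm n \<xi>) \<longlonglongrightarrow> opnorm n x * 0 * sdnorm n \<xi>"
    unfolding d_def by (intro tendsto_intros sdnorm_trunc_tendsto n)
  then have "(\<lambda>N. opnorm n x * sdnorm n (d N) * sdnorm n \<xi>) \<longlonglongrightarrow> 0"
    by simp
  from Lim_null_comparison[OF always_eventually[OF allI[OF le]] this]
  have "(\<lambda>N. pairing (x \<eta>) \<xi> - pairing (x (trunc N \<eta>)) \<xi>) \<longlonglongrightarrow> 0" .
  from tendsto_diff[OF tendsto_const[of "pairing (x \<eta>) \<xi>"] this] show ?thesis by simp
qed

text \<open>Linearity on truncations followed by the limit. An operator is thus determined by its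
  columns \<open>x (unitv j)\<close>, which serves both the construction of the adjoint and
  faithfulness.\<close>

lemma pairing_op_expand:
  assumes x: "x \<in> Sspace" and \<xi>: "\<xi> \<in> sdual" and \<eta>: "\<eta> \<in> sdual"
  shows "(\<lambda>j. \<eta> j * pairing (x (unitv j)) \<xi>) sums pairing (x \<eta>) \<xi>"
proof -
  have "pairing (x (trunc N \<eta>)) \<xi> = (\<Sum>j<N. \<eta> j * pairing (x (unitv j)) \<xi>)" for N
  proof (induction N)
    case 0
    have "trunc 0 \<eta> = (\<lambda>i. 0)" by (simp add: trunc_def)
    then show ?case by (simp add: Sspace_zero[OF x] pairing_def)
  next
    case (Suc N)
    then show ?case
      unfolding trunc_Suc Sspace_lincomb[OF x trunc_in_sdual unitv_in_sdual]
      by (subst pairing_lincomb_left) (simp_all add: Sspace_sspace[OF x] \<xi>)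
  qed
  then show ?thesis
    unfolding sums_def using pairing_op_trunc_tendsto[OF assms] by simp
qed

lemma op_eq_zero_of_unitv:
  assumes x: "x \<in> Sspace" and z: "\<And>j. x (unitv j) = (\<lambda>i. 0)"
  shows "x = (\<lambda>\<xi> i. 0)"
proof (intro ext)
  fix \<eta> i
  show "x \<eta> i = 0"
  proof (cases "\<eta> \<in> sdual")
    case True
    have "(\<lambda>j. \<eta> j * pairing (x (unitv j)) (unitv i)) sums pairing (x \<eta>) (unitv i)"
      by (rule pairing_op_expand[OF x unitv_in_sdual True])
    moreover have "(\<lambda>j. \<eta> j * pairing (x (unitv j)) (unitv i)) sums 0"
      unfolding z by (simp add: pairing_def)
    ultimately have "pairing (x \<eta>) (unitv i) = 0" by (rule sums_unique2)
    moreover have "pairing (x \<eta>) (unitv i) = x \<eta> i"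
      unfolding pairing_def by (subst suminf_finite[of "{i}"]) (auto simp: unitv_def)
    ultimately show ?thesis by simp
  qed (simp add: Sspace_outside[OF x])
qed

section \<open>Existence and uniqueness of the adjoint\<close>

text \<open>The coordinates are forced by testing the adjoint relation on unit vectors; this
  candidate supplies existence for the definite description in \<open>adj\<close>.\<close>

definition adjop :: "op \<Rightarrow> op" where
  "adjop x \<xi> = (if \<xi> \<in> sdual then (\<lambda>i. pairing \<xi> (x (unitv i))) else (\<lambda>i. 0))"

lemma adjop_pairing:
  assumes x: "x \<in> Sspace" and \<xi>: "\<xi> \<in> sdual" and \<eta>: "\<eta> \<in> sdual"
  shows "pairing (adjop x \<xi>) \<eta> = pairing \<xi> (x \<eta>)"
proof -
  have "(\<lambda>j. cnj (\<eta> j * pairing (x (unitv j)) \<xi>)) sums cnj (pairing (x \<eta>) \<xi>)"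
    unfolding sums_cnj by (rule pairing_op_expand[OF assms])
  then have "(\<lambda>j. adjop x \<xi> j * cnj (\<eta> j)) sums pairing \<xi> (x \<eta>)"
    by (simp add: adjop_def \<xi> pairing_cnj[OF \<xi> Sspace_sspace[OF x]] mult.commute)
  then show ?thesis unfolding pairing_def[of "adjop x \<xi>"] by (rule sums_unique[symmetric])
qed

text \<open>Duality of the weighted norms: testing the adjoint relation against an extremal vector
  bounds a partial sum \<open>S\<close> of the squared norm by \<open>S \<le> M * sqrt S\<close>,
  with \<open>M\<close> the claimed bound, hence \<open>S \<le> M\<^sup>2\<close> uniformly.\<close>

lemma adjop_bound:
  assumes x: "x \<in> Sspace" and \<xi>: "\<xi> \<in> sdualn n"
  shows "summable (\<lambda>i. (cmod (adjop x \<xi> i))\<^sup>2 * real (Suc i) ^ (2*n))"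
    and "snorm n (adjop x \<xi>) \<le> opnorm n x * sdnorm n \<xi>"
proof -
  let ?y = "adjop x \<xi>" and ?w = "\<lambda>i. real (Suc i) ^ (2*n)"
  have \<xi>': "\<xi> \<in> sdual" using \<xi> sdualn_subset_sdual by blast
  have M: "0 \<le> opnorm n x * sdnorm n \<xi>"
    using opnorm_nonneg[OF x] sdnorm_nonneg[OF \<xi>] by simp
  have partial: "(\<Sum>i<N. (cmod (?y i))\<^sup>2 * ?w i) \<le> (opnorm n x * sdnorm n \<xi>)\<^sup>2" for N
  proof -
    define S where "S = (\<Sum>i<N. (cmod (?y i))\<^sup>2 * ?w i)"
    \<comment> \<open>The extremal vector for the weighted norm of \<open>?y\<close>. It is
      truncated because \<open>?y\<close> is not yet known to lie in s; its pairing with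
      \<open>?y\<close> is \<open>S\<close> and its dual norm is \<open>sqrt S\<close>.\<close>
    define \<eta> where "\<eta> = trunc N (\<lambda>i. ?y i * complex_of_real (?w i))"
    have S: "S \<ge> 0" by (simp add: S_def sum_nonneg)
    have \<eta>: "\<eta> \<in> sdual" "\<eta> \<in> sdualn n"
      unfolding \<eta>_def using trunc_in_sdual trunc_in_sspace sspace_subset_sdualn by blast+
    have "(\<Sum>i. (cmod (\<eta> i))\<^sup>2 / ?w i) = (\<Sum>i<N. (cmod (\<eta> i))\<^sup>2 / ?w i)"
      by (rule suminf_finite) (auto simp: \<eta>_def trunc_def)
    also have "\<dots> = S"
      unfolding S_def
      by (intro sum.cong refl)
        (simp add: \<eta>_def trunc_def norm_mult norm_power power_mult_distrib power2_eq_square del: of_nat_Suc)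
    finally have n: "sdnorm n \<eta> = sqrt S" by (simp add: sdnorm_def)
    have "pairing ?y \<eta> = (\<Sum>i<N. ?y i * cnj (\<eta> i))"
      unfolding pairing_def by (rule suminf_finite) (auto simp: \<eta>_def trunc_def)
    also have "\<dots> = complex_of_real S"
      unfolding S_def of_real_sum
      by (intro sum.cong refl) (simp add: \<eta>_def trunc_def complex_norm_square[symmetric] del: of_nat_Suc of_real_power)
    finally have "complex_of_real S = pairing \<xi> (x \<eta>)" using adjop_pairing[OF x \<xi>' \<eta>(1)] by simp
    then have "S = cmod (pairing (x \<eta>) \<xi>)"
      using S unfolding pairing_cnj[OF \<xi>' Sspace_sspace[OF x]] by (metis complex_mod_cnj norm_of_real abs_of_nonneg)
    also have "\<dots> \<le> snorm n (x \<eta>) * sdnorm n \<xi>"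
      by (rule pairing_bound[OF Sspace_sspace[OF x] \<xi>])
    also have "\<dots> \<le> opnorm n x * sdnorm n \<eta> * sdnorm n \<xi>"
      by (intro mult_right_mono opnorm_bound[OF x \<eta>(2)] sdnorm_nonneg[OF \<xi>])
    finally have "sqrt S * sqrt S \<le> (opnorm n x * sdnorm n \<xi>) * sqrt S" using S by (simp add: n mult_ac)
    then have "sqrt S \<le> opnorm n x * sdnorm n \<xi>"
    proof (cases "S = 0")
      case False
      then have "sqrt S > 0" using S by simp
      with \<open>sqrt S * sqrt S \<le> (opnorm n x * sdnorm n \<xi>) * sqrt S\<close> show ?thesis
        by (rule mult_right_le_imp_le)
    qed (use M in simp)
    then show ?thesis unfolding S_def[symmetric] by (rule sqrt_le_D)
  qed
  show s: "summable (\<lambda>i. (cmod (?y i))\<^sup>2 * ?w i)"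
    by (rule bounded_imp_summable[where B="(opnorm n x * sdnorm n \<xi>)\<^sup>2"])
      (use partial[of "Suc _"] in \<open>auto simp: lessThan_Suc_atMost\<close>)
  show "snorm n ?y \<le> opnorm n x * sdnorm n \<xi>"
    unfolding snorm_def by (rule real_le_lsqrt[OF M suminf_le_const[OF s partial]])
qed

lemma adjop_in_Sspace:
  assumes x: "x \<in> Sspace"
  shows "adjop x \<in> Sspace"
proof (rule SspaceI)
  show "adjop x (\<lambda>i. a * \<xi> i + b * \<eta> i) = (\<lambda>i. a * adjop x \<xi> i + b * adjop x \<eta> i)"
    if "\<xi> \<in> sdual" "\<eta> \<in> sdual" for \<xi> \<eta> a b
    using that by (simp add: adjop_def sdual_lincomb pairing_lincomb_left' Sspace_sspace[OF x])
  show "adjop x \<xi> \<in> sspace" if \<xi>: "\<xi> \<in> sdual" for \<xi>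
    unfolding sspace_def mem_Collect_eq
  proof
    fix n
    \<comment> \<open>The bound is available only at indices where \<xi> has finite dual norm;
      passing to a larger index also dominates the weight belonging to \<open>n\<close>.\<close>
    obtain m where m: "\<xi> \<in> sdualn m" using sdualD[OF \<xi>] by blast
    then have "\<xi> \<in> sdualn (max m n)" using sdualn_mono[of m "max m n"] by auto
    from adjop_bound(1)[OF x this]
    show "summable (\<lambda>i. (cmod (adjop x \<xi> i))\<^sup>2 * real (Suc i) ^ (2*n))"
    proof (rule summable_comparison_test')
      fix i
      have "real (Suc i) ^ (2*n) \<le> real (Suc i) ^ (2 * max m n)" by (intro power_increasing) auto
      then show "norm ((cmod (adjop x \<xi> i))\<^sup>2 * real (Suc i) ^ (2*n)) \<le> (cmod (adjop x \<xi> i))\<^sup>2 * real (Suc i) ^ (2 * max m n)"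
        by (simp add: mult_left_mono del: of_nat_Suc)
    qed
  qed
  fix n \<xi> assume \<xi>: "\<xi> \<in> dball n"
  then have "snorm n (adjop x \<xi>) \<le> opnorm n x * sdnorm n \<xi>"
    by (intro adjop_bound(2)[OF x]) (simp add: dball_alt)
  also have "\<dots> \<le> opnorm n x * 1"
    using \<xi> opnorm_nonneg[OF x] by (intro mult_left_mono) (auto simp: dball_alt)
  finally show "snorm n (adjop x \<xi>) \<le> opnorm n x" by simp
qed (simp add: adjop_def)

text \<open>Pairing with unit vectors recovers coordinates, so two candidates agree on s'; outside
  s' all members of \<open>Sspace\<close> vanish, which makes the description unique as a total
  function.\<close>

lemma adj_eqI:
  assumes x: "x \<in> Sspace" and y: "y \<in> Sspace"
    and p: "\<And>\<xi> \<eta>. \<xi> \<in> sdual \<Longrightarrow> \<eta> \<in> sdual \<Longrightarrow> pairing (y \<xi>) \<eta> = pairing \<xi> (x \<eta>)"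
  shows "adj x = y"
  unfolding adj_def
proof (rule the_equality)
  fix z assume z: "z \<in> Sspace \<and> (\<forall>\<xi>\<in>sdual. \<forall>\<eta>\<in>sdual. pairing (z \<xi>) \<eta> = pairing \<xi> (x \<eta>))"
  have e: "pairing \<zeta> (unitv i) = \<zeta> i" for \<zeta> i
    unfolding pairing_def by (subst suminf_finite[of "{i}"]) (auto simp: unitv_def)
  show "z = y"
  proof (intro ext)
    fix \<xi> i
    show "z \<xi> i = y \<xi> i"
    proof (cases "\<xi> \<in> sdual")
      case True
      then have "pairing (z \<xi>) (unitv i) = pairing (y \<xi>) (unitv i)"
        using z p unitv_in_sdual by simp
      then show ?thesis by (simp add: e)
    next
      case False
      then show ?thesis using z y Sspace_outside by metis
    qed
  qed
qed (use assms in auto)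

lemma adj_eq_adjop: "x \<in> Sspace \<Longrightarrow> adj x = adjop x"
  by (rule adj_eqI) (simp_all add: adjop_in_Sspace adjop_pairing)

lemma adj_in_Sspace: "x \<in> Sspace \<Longrightarrow> adj x \<in> Sspace"
  by (simp add: adj_eq_adjop adjop_in_Sspace)

lemma adj_pairing:
  "x \<in> Sspace \<Longrightarrow> \<xi> \<in> sdual \<Longrightarrow> \<eta> \<in> sdual \<Longrightarrow> pairing (adj x \<xi>) \<eta> = pairing \<xi> (x \<eta>)"
  by (simp add: adj_eq_adjop adjop_pairing)

lemma adj_pairing':
  assumes "x \<in> Sspace" "\<xi> \<in> sdual" "\<eta> \<in> sdual"
  shows "pairing (x \<xi>) \<eta> = pairing \<xi> (adj x \<eta>)"
  using adj_pairing[OF assms(1,3,2)] assms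
  by (simp add: pairing_cnj[OF _ Sspace_sspace] adj_in_Sspace)

lemma adj_scale:
  assumes x: "x \<in> Sspace"
  shows "adj (\<lambda>\<xi> i. a * x \<xi> i) = (\<lambda>\<xi> i. cnj a * adj x \<xi> i)"
proof (rule adj_eqI[OF Sspace_scale_closed[OF x] Sspace_scale_closed[OF adj_in_Sspace[OF x]]])
  fix \<xi> \<eta> assume d: "\<xi> \<in> sdual" "\<eta> \<in> sdual"
  have "pairing (\<lambda>i. cnj a * adj x \<xi> i) \<eta> = cnj a * pairing (adj x \<xi>) \<eta>"
    using pairing_lincomb_left[OF Sspace_sspace[OF adj_in_Sspace[OF x]] zero_in_sspace d(2), where b=0] by simp
  also have "\<dots> = cnj (a * pairing (x \<eta>) \<xi>)"
    by (simp add: adj_pairing[OF x d] pairing_cnj[OF d(1) Sspace_sspace[OF x]])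
  also have "a * pairing (x \<eta>) \<xi> = pairing (\<lambda>i. a * x \<eta> i) \<xi>"
    using pairing_lincomb_left[OF Sspace_sspace[OF x] zero_in_sspace d(1), where b=0] by simp
  finally show "pairing (\<lambda>i. cnj a * adj x \<xi> i) \<eta> = pairing \<xi> (\<lambda>i. a * x \<eta> i)"
    by (simp add: pairing_cnj[OF d(1) sspace_scale[OF Sspace_sspace[OF x]]])
qed

section \<open>Vector states and positive operators\<close>

lemma vstate_bound:
  assumes x: "x \<in> Sspace" and \<xi>: "\<xi> \<in> dball k"
  shows "cmod (vstate \<xi> x) \<le> opnorm k x"
proof -
  have s: "\<xi> \<in> sdualn k" "sdnorm k \<xi> \<le> 1" using \<xi> by (simp_all add: dball_alt)
  have "cmod (vstate \<xi> x) \<le> snorm k (x \<xi>) * sdnorm k \<xi>"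
    unfolding vstate_def by (rule pairing_bound[OF Sspace_sspace[OF x] s(1)])
  also have "\<dots> \<le> snorm k (x \<xi>) * 1"
    using s snorm_nonneg[OF Sspace_sspace[OF x]] by (intro mult_left_mono)
  also have "\<dots> \<le> opnorm k x" using opnorm_upper[OF x \<xi>] by simp
  finally show ?thesis .
qed

lemma vstate_lincomb:
  assumes "x \<in> Sspace" "y \<in> Sspace" "\<xi> \<in> sdual"
  shows "vstate \<xi> (\<lambda>\<xi> i. a * x \<xi> i + b * y \<xi> i) = a * vstate \<xi> x + b * vstate \<xi> y"
  unfolding vstate_def by (intro pairing_lincomb_left Sspace_sspace assms)

lemma vstate_zero: "x \<in> Sspace \<Longrightarrow> vstate (\<lambda>i. 0) x = 0"
  by (simp add: vstate_def Sspace_zero pairing_def)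

lemma pairing_self:
  assumes "\<zeta> \<in> sspace"
  shows "pairing \<zeta> \<zeta> = complex_of_real (\<Sum>i. (cmod (\<zeta> i))\<^sup>2)" and "summable (\<lambda>i. (cmod (\<zeta> i))\<^sup>2)"
proof -
  have "summable (\<lambda>i. (cmod (\<zeta> i))\<^sup>2 * real (Suc i) ^ (2*0))"
    using assms unfolding sspace_def by blast
  then show s: "summable (\<lambda>i. (cmod (\<zeta> i))\<^sup>2)" by simp
  from sums_of_real[OF summable_sums[OF s], where 'a=complex]
  show "pairing \<zeta> \<zeta> = complex_of_real (\<Sum>i. (cmod (\<zeta> i))\<^sup>2)"
    unfolding pairing_def complex_norm_square by (rule sums_unique[symmetric])
qed

lemma Re_pairing_self_nonneg: "\<zeta> \<in> sspace \<Longrightarrow> 0 \<le> Re (pairing \<zeta> \<zeta>)"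
  using pairing_self by (simp add: suminf_nonneg)

lemma Re_pairing_self_pos:
  assumes "\<zeta> \<in> sspace" "\<zeta> \<noteq> (\<lambda>i. 0)"
  shows "0 < Re (pairing \<zeta> \<zeta>)"
proof -
  obtain i where "\<zeta> i \<noteq> 0" using assms(2) by auto
  then have "0 < (\<Sum>i. (cmod (\<zeta> i))\<^sup>2)"
    using pairing_self(2)[OF assms(1)] by (intro suminf_pos2[where i=i]) auto
  then show ?thesis using pairing_self(1)[OF assms(1)] by simp
qed

text \<open>Expands the nonnegative pairing of the difference of the two vectors with
  itself.\<close>

lemma Re_pairing_le:
  assumes z: "\<zeta> \<in> sspace" "\<zeta>' \<in> sspace"
  shows "2 * Re (pairing \<zeta> \<zeta>') \<le> Re (pairing \<zeta> \<zeta>) + Re (pairing \<zeta>' \<zeta>')"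
proof -
  have d: "\<zeta> \<in> sdual" "\<zeta>' \<in> sdual" using z sspace_subset_sdual by blast+
  let ?diff = "\<lambda>i. 1 * \<zeta> i + (-1) * \<zeta>' i"
  have dd: "?diff \<in> sspace" "?diff \<in> sdual" using sspace_lincomb[OF z, of 1 "-1"] sspace_subset_sdual by blast+
  have e: "pairing \<theta> ?diff = pairing \<theta> \<zeta> - pairing \<theta> \<zeta>'" if "\<theta> \<in> sspace" for \<theta>
  proof -
    have \<theta>: "\<theta> \<in> sdual" using that sspace_subset_sdual by blast
    show ?thesis
      unfolding pairing_cnj[OF \<theta> dd(1)] pairing_cnj[OF \<theta> z(1)] pairing_cnj[OF \<theta> z(2)]
        pairing_lincomb_left[OF z \<theta>] by simp
  qed
  have "pairing ?diff ?diff = pairing \<zeta> ?diff - pairing \<zeta>' ?diff"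
    unfolding pairing_lincomb_left[OF z dd(2)] by simp
  also have "\<dots> = pairing \<zeta> \<zeta> - pairing \<zeta> \<zeta>' - (cnj (pairing \<zeta> \<zeta>') - pairing \<zeta>' \<zeta>')"
    by (simp only: e[OF z(1)] e[OF z(2)] pairing_cnj[OF d(2) z(1)])
  finally show ?thesis using Re_pairing_self_nonneg[OF dd(1)] by simp
qed

lemma
  assumes x: "x \<in> Sspace" and \<xi>: "\<xi> \<in> sdual" and \<eta>: "\<eta> \<in> sdual"
  shows pairing_adj_mult: "pairing (opmult (adj x) x \<xi>) \<eta> = pairing (x \<xi>) (x \<eta>)"
    and pairing_mult_adj: "pairing (opmult x (adj x) \<xi>) \<eta> = pairing (adj x \<xi>) (adj x \<eta>)"
proof -
  have "x \<xi> \<in> sdual" "adj x \<xi> \<in> sdual"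
    using Sspace_sspace[OF x] Sspace_sspace[OF adj_in_Sspace[OF x]] sspace_subset_sdual by blast+
  then show "pairing (opmult (adj x) x \<xi>) \<eta> = pairing (x \<xi>) (x \<eta>)"
    "pairing (opmult x (adj x) \<xi>) \<eta> = pairing (adj x \<xi>) (adj x \<eta>)"
    by (simp_all add: opmult_def adj_pairing[OF x] adj_pairing'[OF x] \<eta>)
qed

lemma adj_mult_in_Sspace: "x \<in> Sspace \<Longrightarrow> opmult (adj x) x \<in> Sspace"
  and mult_adj_in_Sspace: "x \<in> Sspace \<Longrightarrow> opmult x (adj x) \<in> Sspace"
  by (simp_all add: opmult_in_Sspace adj_in_Sspace)

lemma
  assumes "x \<in> Sspace" "\<xi> \<in> sdual"
  shows Re_vstate_adj_mult_nonneg: "0 \<le> Re (vstate \<xi> (opmult (adj x) x))"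
    and Re_vstate_mult_adj_nonneg: "0 \<le> Re (vstate \<xi> (opmult x (adj x)))"
  using assms by (simp_all add: vstate_def pairing_adj_mult pairing_mult_adj
      Re_pairing_self_nonneg Sspace_sspace adj_in_Sspace)

lemma pairing_opsum:
  assumes "\<And>j. j < m \<Longrightarrow> xs j \<in> Sspace" "\<eta> \<in> sdual"
  shows "pairing (opsum m xs \<xi>) \<eta> = (\<Sum>j<m. pairing (xs j \<xi>) \<eta>)"
  using assms(1)
proof (induction m)
  case 0
  then show ?case by (simp add: opsum_def pairing_def)
next
  case (Suc m)
  have "opsum (Suc m) xs \<xi> = (\<lambda>i. 1 * opsum m xs \<xi> i + 1 * xs m \<xi> i)" by (simp add: opsum_def)
  moreover have "pairing (\<lambda>i. 1 * opsum m xs \<xi> i + 1 * xs m \<xi> i) \<eta>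
      = 1 * pairing (opsum m xs \<xi>) \<eta> + 1 * pairing (xs m \<xi>) \<eta>"
    using Suc.prems by (intro pairing_lincomb_left Sspace_sspace opsum_in_Sspace assms(2)) auto
  ultimately show ?case using Suc by simp
qed

lemma vstate_opsum:
  assumes "\<And>j. j < m \<Longrightarrow> xs j \<in> Sspace" "\<xi> \<in> sdual"
  shows "vstate \<xi> (opsum m xs) = (\<Sum>j<m. vstate \<xi> (xs j))"
  unfolding vstate_def by (rule pairing_opsum[OF assms])

text \<open>Cauchy-Schwarz for the form of \<open>A\<close>, in additive shape. Unlike the version
  with square roots it is linear in \<open>A\<close>, so sums inherit it; \<eta> = 0 gives back
  nonnegativity of the quadratic form.\<close>

definition positive_op :: "op \<Rightarrow> bool" where
  "positive_op A \<longleftrightarrow> A \<in> Sspace \<and>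
    (\<forall>\<xi>\<in>sdual. \<forall>\<eta>\<in>sdual. 2 * Re (pairing (A \<xi>) \<eta>) \<le> Re (vstate \<xi> A) + Re (vstate \<eta> A))"

lemma positive_op_adj_mult: "x \<in> Sspace \<Longrightarrow> positive_op (opmult (adj x) x)"
  and positive_op_mult_adj: "x \<in> Sspace \<Longrightarrow> positive_op (opmult x (adj x))"
  by (simp_all add: positive_op_def adj_mult_in_Sspace mult_adj_in_Sspace vstate_def
      pairing_adj_mult pairing_mult_adj Re_pairing_le Sspace_sspace adj_in_Sspace)

lemma positive_op_opsum:
  assumes "\<And>j. j < m \<Longrightarrow> positive_op (xs j)"
  shows "positive_op (opsum m xs)"
proof -
  have S: "\<And>j. j < m \<Longrightarrow> xs j \<in> Sspace" using assms by (simp add: positive_op_def)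
  show ?thesis
    unfolding positive_op_def vstate_def
    using assms
    by (auto simp: opsum_in_Sspace[OF S] pairing_opsum[OF S] sum_distrib_left sum.distrib[symmetric]
        positive_op_def vstate_def intro!: sum_mono)
qed

text \<open>The norm of \<open>A \<xi>\<close> is the value of its pairing with a norming vector
  \<eta> of the dual unit ball, and positivity bounds that value by the mean of the quadratic form
  at \<xi> and at \<eta>.\<close>

lemma positive_op_opnorm_le:
  assumes A: "positive_op A" and le: "\<And>\<xi>. \<xi> \<in> dball k \<Longrightarrow> Re (vstate \<xi> A) \<le> s"
  shows "opnorm k A \<le> s"
proof (rule opnorm_least)
  fix \<xi> assume \<xi>: "\<xi> \<in> dball k"
  have AS: "A \<in> Sspace" using A by (simp add: positive_op_def)
  define \<zeta> where "\<zeta> = A \<xi>"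
  have \<zeta>: "\<zeta> \<in> sspace" unfolding \<zeta>_def by (rule Sspace_sspace[OF AS])
  define r where "r = snorm k \<zeta>"
  let ?w = "\<lambda>i. real (Suc i) ^ (2*k)"
  have sm: "summable (\<lambda>i. (cmod (\<zeta> i))\<^sup>2 * ?w i)" using \<zeta> by (simp add: sspace_def)
  have s0: "0 \<le> s" using le[OF zero_in_dball] by (simp add: vstate_zero[OF AS])
  have r0: "r \<ge> 0" unfolding r_def by (rule snorm_nonneg[OF \<zeta>])
  have r2: "r\<^sup>2 = (\<Sum>i. (cmod (\<zeta> i))\<^sup>2 * ?w i)"
    unfolding r_def snorm_def using sm by (simp add: suminf_nonneg)
  show "snorm k (A \<xi>) \<le> s"
  proof (cases "r = 0")
    case True
    then show ?thesis using s0 by (simp add: r_def \<zeta>_def)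
  next
    case False
    then have r: "r > 0" using r0 by simp
    \<comment> \<open>The norming vector: multiplying by weight over norm makes its dual norm one
      and its pairing with \<zeta> equal to \<open>r\<close>.\<close>
    define \<eta> where "\<eta> i = complex_of_real (?w i / r) * \<zeta> i" for i
    have e: "(cmod (\<eta> i))\<^sup>2 / ?w i = (1 / r\<^sup>2) * ((cmod (\<zeta> i))\<^sup>2 * ?w i)" for i
    proof -
      have "cmod (\<eta> i) = ?w i / r * cmod (\<zeta> i)"
        unfolding \<eta>_def norm_mult norm_of_real using r by (simp del: of_nat_Suc)
      then show ?thesis by (simp add: field_simps power2_eq_square del: of_nat_Suc)
    qed
    have "(\<Sum>i. (cmod (\<eta> i))\<^sup>2 / ?w i) = (1 / r\<^sup>2) * r\<^sup>2"
      unfolding e r2 by (rule suminf_mult[OF sm])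
    then have \<eta>: "\<eta> \<in> dball k"
      unfolding dball_def sdnorm_def mem_Collect_eq using r summable_mult[OF sm, of "1 / r\<^sup>2"] by (simp add: e del: of_nat_Suc)
    have "(\<lambda>i. complex_of_real (1 / r * ((cmod (\<zeta> i))\<^sup>2 * ?w i))) sums complex_of_real (1 / r * r\<^sup>2)"
      unfolding r2 by (intro sums_of_real sums_mult summable_sums sm)
    moreover have "complex_of_real (1 / r * ((cmod (\<zeta> i))\<^sup>2 * ?w i)) = \<zeta> i * cnj (\<eta> i)" for i
      unfolding \<eta>_def of_real_mult complex_norm_square by (simp add: of_real_divide del: of_nat_Suc)
    ultimately have "(\<lambda>i. \<zeta> i * cnj (\<eta> i)) sums complex_of_real (1 / r * r\<^sup>2)" by simp
    then have "pairing \<zeta> \<eta> = complex_of_real (1 / r * r\<^sup>2)" unfolding pairing_def by (rule sums_unique[symmetric])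
    then have "Re (pairing (A \<xi>) \<eta>) = r" using r by (simp add: \<zeta>_def power2_eq_square)
    moreover have "2 * Re (pairing (A \<xi>) \<eta>) \<le> Re (vstate \<xi> A) + Re (vstate \<eta> A)"
      using A \<xi> \<eta> dball_subset_sdual unfolding positive_op_def by blast
    ultimately show ?thesis using le[OF \<xi>] le[OF \<eta>] by (simp add: r_def \<zeta>_def)
  qed
qed

section \<open>States as a weak closure\<close>

text \<open>The functionals are cut off outside \<open>Sspace\<close>: only then is the hull relatively compact in the
  product topology of \<open>op \<Rightarrow> complex\<close>.\<close>

definition state_hull :: "nat \<Rightarrow> (op \<Rightarrow> complex) set" where
  "state_hull k = {\<phi>. \<exists>m (t::nat \<Rightarrow> real) \<xi>. (\<forall>i<m. t i \<ge> 0 \<and> \<xi> i \<in> dball k) \<and> (\<Sum>i<m. t i) = 1 \<and>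
     \<phi> = (\<lambda>x. if x \<in> Sspace then \<Sum>i<m. complex_of_real (t i) * vstate (\<xi> i) x else 0)}"

lemma state_hullE:
  assumes "\<phi> \<in> state_hull k"
  obtains m t \<xi> where "\<forall>i<m. t i \<ge> 0 \<and> \<xi> i \<in> dball k" "(\<Sum>i<m::nat. t i) = (1::real)"
    "\<phi> = (\<lambda>x. if x \<in> Sspace then \<Sum>i<m. complex_of_real (t i) * vstate (\<xi> i) x else 0)"
  using assms unfolding state_hull_def by blast

lemma vstate_in_state_hull:
  assumes "\<xi> \<in> dball k"
  shows "(\<lambda>x. if x \<in> Sspace then vstate \<xi> x else 0) \<in> state_hull k"
  unfolding state_hull_def mem_Collect_eq using assms
  by (intro exI[of _ "1::nat"] exI[of _ "\<lambda>_. 1::real"] exI[of _ "\<lambda>_. \<xi>"]) (simp cong: if_cong)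

lemma sum_lessThan_append:
  fixes g h :: "nat \<Rightarrow> 'a::comm_monoid_add"
  shows "(\<Sum>i<m + l. if i < m then g i else h (i - m)) = (\<Sum>i<m. g i) + (\<Sum>i<l. h i)"
  by (induction l) (simp_all add: add.assoc)

lemma state_hull_convex:
  assumes "\<phi> \<in> state_hull k" "\<psi> \<in> state_hull k" "0 \<le> c" "c \<le> 1"
  shows "(\<lambda>x. complex_of_real (1 - c) * \<phi> x + complex_of_real c * \<psi> x) \<in> state_hull k"
proof -
  obtain m :: nat and t \<xi> where 1: "\<forall>i<m. t i \<ge> 0 \<and> \<xi> i \<in> dball k" "(\<Sum>i<m. t i) = 1"
    and \<phi>: "\<phi> = (\<lambda>x. if x \<in> Sspace then \<Sum>i<m. complex_of_real (t i) * vstate (\<xi> i) x else 0)"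
    by (rule state_hullE[OF assms(1)])
  obtain l :: nat and s \<eta> where 2: "\<forall>i<l. s i \<ge> 0 \<and> \<eta> i \<in> dball k" "(\<Sum>i<l. s i) = 1"
    and \<psi>: "\<psi> = (\<lambda>x. if x \<in> Sspace then \<Sum>i<l. complex_of_real (s i) * vstate (\<eta> i) x else 0)"
    by (rule state_hullE[OF assms(2)])
  \<comment> \<open>The two convex combinations are concatenated, with their weights scaled by
    \<open>1 - c\<close> and \<open>c\<close>.\<close>
  define r where "r i = (if i < m then (1 - c) * t i else c * s (i - m))" for i
  define \<zeta> where "\<zeta> i = (if i < m then \<xi> i else \<eta> (i - m))" for i
  have "\<forall>i<m+l. r i \<ge> 0 \<and> \<zeta> i \<in> dball k"
    using 1(1) 2(1) assms(3,4) by (auto simp: r_def \<zeta>_def)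
  moreover have "(\<Sum>i<m+l. r i) = 1"
    unfolding r_def sum_lessThan_append[where h="\<lambda>i. c * s i"] sum_distrib_left[symmetric] 1(2) 2(2) by simp
  moreover have "(\<lambda>x. complex_of_real (1 - c) * \<phi> x + complex_of_real c * \<psi> x)
      = (\<lambda>x. if x \<in> Sspace then \<Sum>i<m+l. complex_of_real (r i) * vstate (\<zeta> i) x else 0)"
  proof (rule ext)
    fix x
    have "(\<Sum>i<m+l. complex_of_real (r i) * vstate (\<zeta> i) x)
        = (\<Sum>i<m+l. if i < m then complex_of_real (1 - c) * (complex_of_real (t i) * vstate (\<xi> i) x)
            else complex_of_real c * (complex_of_real (s (i - m)) * vstate (\<eta> (i - m)) x))"
      by (intro sum.cong) (auto simp: r_def \<zeta>_def)
    also have "\<dots> = complex_of_real (1 - c) * (\<Sum>i<m. complex_of_real (t i) * vstate (\<xi> i) x)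
        + complex_of_real c * (\<Sum>i<l. complex_of_real (s i) * vstate (\<eta> i) x)"
      unfolding sum_distrib_left
      by (rule sum_lessThan_append[where h="\<lambda>i. complex_of_real c * (complex_of_real (s i) * vstate (\<eta> i) x)"])
    finally show "complex_of_real (1 - c) * \<phi> x + complex_of_real c * \<psi> x
      = (if x \<in> Sspace then \<Sum>i<m+l. complex_of_real (r i) * vstate (\<zeta> i) x else 0)"
      unfolding \<phi> \<psi> by simp
  qed
  ultimately show ?thesis unfolding state_hull_def by blast
qed

lemma state_hull_bound:
  assumes "\<phi> \<in> state_hull k" "x \<in> Sspace"
  shows "cmod (\<phi> x) \<le> opnorm k x"
proof -
  obtain m :: nat and t \<xi> where 1: "\<forall>i<m. t i \<ge> 0 \<and> \<xi> i \<in> dball k" "(\<Sum>i<m. t i) = (1::real)"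
    and \<phi>: "\<phi> = (\<lambda>x. if x \<in> Sspace then \<Sum>i<m. complex_of_real (t i) * vstate (\<xi> i) x else 0)"
    by (rule state_hullE[OF assms(1)])
  have "cmod (\<Sum>i<m. complex_of_real (t i) * vstate (\<xi> i) x) \<le> (\<Sum>i<m. t i * opnorm k x)"
    using 1(1) vstate_bound[OF assms(2)] by (intro sum_norm_le) (auto simp: norm_mult intro!: mult_left_mono)
  then show ?thesis using assms(2) by (simp add: \<phi> sum_distrib_right[symmetric] 1(2))
qed

lemma state_hull_lincomb:
  assumes "\<phi> \<in> state_hull k" "x \<in> Sspace" "y \<in> Sspace"
  shows "\<phi> (\<lambda>\<xi> i. a * x \<xi> i + b * y \<xi> i) = a * \<phi> x + b * \<phi> y"
proof -
  obtain m :: nat and t \<xi> where 1: "\<forall>i<m. t i \<ge> 0 \<and> \<xi> i \<in> dball k" "(\<Sum>i<m. t i) = (1::real)"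
    and \<phi>: "\<phi> = (\<lambda>x. if x \<in> Sspace then \<Sum>i<m. complex_of_real (t i) * vstate (\<xi> i) x else 0)"
    by (rule state_hullE[OF assms(1)])
  have "vstate (\<xi> i) (\<lambda>\<xi> i. a * x \<xi> i + b * y \<xi> i) = a * vstate (\<xi> i) x + b * vstate (\<xi> i) y" if "i < m" for i
    using 1(1) dball_subset_sdual that by (intro vstate_lincomb assms(2,3)) blast
  then have "(\<Sum>i<m. complex_of_real (t i) * vstate (\<xi> i) (\<lambda>\<xi> i. a * x \<xi> i + b * y \<xi> i))
      = (\<Sum>i<m. a * (complex_of_real (t i) * vstate (\<xi> i) x) + b * (complex_of_real (t i) * vstate (\<xi> i) y))"
    by (intro sum.cong refl) (simp add: algebra_simps)
  then show ?thesis
    using assms(2,3) Sspace_lincomb_closed[OF assms(2,3)]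
    by (simp add: \<phi> sum.distrib sum_distrib_left)
qed

lemma state_hull_nonneg:
  assumes "\<phi> \<in> state_hull k" "A \<in> Sspace" "\<And>\<xi>. \<xi> \<in> dball k \<Longrightarrow> 0 \<le> Re (vstate \<xi> A)"
  shows "0 \<le> Re (\<phi> A)"
proof -
  obtain m :: nat and t \<xi> where 1: "\<forall>i<m. t i \<ge> 0 \<and> \<xi> i \<in> dball k" "(\<Sum>i<m. t i) = (1::real)"
    and \<phi>: "\<phi> = (\<lambda>x. if x \<in> Sspace then \<Sum>i<m. complex_of_real (t i) * vstate (\<xi> i) x else 0)"
    by (rule state_hullE[OF assms(1)])
  show ?thesis using assms(2,3) 1(1) by (auto simp: \<phi> intro!: sum_nonneg mult_nonneg_nonneg)
qed

text \<open>Banach-Alaoglu in the form of Tychonoff: the hull lies in a product of closed discs of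
  radius \<open>opnorm k x\<close> over \<open>Sspace\<close>, with the single point 0 as factor
  elsewhere.\<close>

lemma compact_closure_state_hull: "compact (closure (state_hull k))"
proof -
  let ?B = "\<lambda>x. if x \<in> Sspace then cball 0 (opnorm k x) else {0::complex}"
  have "compactin (product_topology (\<lambda>_. euclidean) UNIV) (PiE UNIV ?B)"
    by (simp only: compactin_PiE compactin_euclidean_iff) simp
  then have c: "compact (PiE UNIV ?B)"
    by (simp add: euclidean_product_topology)
  have "state_hull k \<subseteq> PiE UNIV ?B"
  proof
    fix \<phi> assume p: "\<phi> \<in> state_hull k"
    then have "\<phi> x = 0" if "x \<notin> Sspace" for x
      using that unfolding state_hull_def by auto
    with state_hull_bound[OF p] show "\<phi> \<in> PiE UNIV ?B" by auto
  qed
  moreover have "closed (PiE UNIV ?B)"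
    using closedin_product_topology[of "\<lambda>_. euclidean" UNIV ?B] by (simp add: euclidean_product_topology)
  ultimately have "closure (state_hull k) \<subseteq> PiE UNIV ?B" by (rule closure_minimal)
  then show ?thesis using compact_Int_closed[OF c closed_closure[of "state_hull k"]] by (simp add: Int_absorb1)
qed

text \<open>The closure is reached in one argument at a time, using continuity of the combination in
  that argument while the other is fixed.\<close>

lemma closure_state_hull_convex:
  assumes "\<phi> \<in> closure (state_hull k)" "\<psi> \<in> closure (state_hull k)" "0 \<le> c" "c \<le> 1"
  shows "(\<lambda>x. complex_of_real (1 - c) * \<phi> x + complex_of_real c * \<psi> x) \<in> closure (state_hull k)"
proof -
  let ?f = "\<lambda>\<phi> \<psi> x. complex_of_real (1 - c) * \<phi> x + complex_of_real c * \<psi> x"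
  have c1: "continuous_on UNIV (\<lambda>\<psi>::op \<Rightarrow> complex. ?f \<phi> \<psi>)" for \<phi>
    by (intro continuous_on_coordinatewise_then_product continuous_intros) simp
  have c2: "continuous_on UNIV (\<lambda>\<phi>::op \<Rightarrow> complex. ?f \<phi> \<psi>)" for \<psi>
    by (intro continuous_on_coordinatewise_then_product continuous_intros) simp
  have a: "?f \<phi> \<psi> \<in> closure (state_hull k)" if "\<phi> \<in> state_hull k" "\<psi> \<in> closure (state_hull k)" for \<phi> \<psi>
  proof -
    have "?f \<phi> ` closure (state_hull k) \<subseteq> closure (state_hull k)"
    proof (rule image_closure_subset[OF continuous_on_subset[OF c1] closed_closure])
      show "?f \<phi> ` state_hull k \<subseteq> closure (state_hull k)"
        using state_hull_convex[OF that(1) _ assms(3,4)] closure_subset by blast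
    qed simp
    then show ?thesis using that(2) by blast
  qed
  have "(\<lambda>\<phi>. ?f \<phi> \<psi>) ` closure (state_hull k) \<subseteq> closure (state_hull k)"
  proof (rule image_closure_subset[OF continuous_on_subset[OF c2] closed_closure])
    show "(\<lambda>\<phi>. ?f \<phi> \<psi>) ` state_hull k \<subseteq> closure (state_hull k)"
      using a assms(2) by blast
  qed simp
  then show ?thesis using assms(1) by blast
qed

lemma closure_state_hull_nonneg:
  assumes "\<phi> \<in> closure (state_hull k)" "A \<in> Sspace" "\<And>\<xi>. \<xi> \<in> dball k \<Longrightarrow> 0 \<le> Re (vstate \<xi> A)"
  shows "0 \<le> Re (\<phi> A)"
proof -
  have "closure (state_hull k) \<subseteq> {\<phi>. 0 \<le> Re (\<phi> A)}"
    using state_hull_nonneg[OF _ assms(2,3)]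
    by (intro closure_minimal closed_Collect_le continuous_intros) auto
  then show ?thesis using assms(1) by blast
qed

text \<open>Each instance of linearity and each norm bound involves finitely many evaluations, so it
  is a closed condition for pointwise convergence and passes from the hull to its closure.\<close>

lemma closure_state_hull_in_Sdual:
  assumes \<phi>: "\<phi> \<in> closure (state_hull k)"
  shows "\<phi> \<in> Sdual"
proof -
  have "\<phi> (\<lambda>\<xi> i. a * x \<xi> i + b * y \<xi> i) = a * \<phi> x + b * \<phi> y" if "x \<in> Sspace" "y \<in> Sspace" for x y a b
  proof -
    have "closure (state_hull k) \<subseteq> {\<phi>. \<phi> (\<lambda>\<xi> i. a * x \<xi> i + b * y \<xi> i) = a * \<phi> x + b * \<phi> y}"
      using state_hull_lincomb[OF _ that]
      by (intro closure_minimal closed_Collect_eq continuous_intros) auto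
    then show ?thesis using \<phi> by blast
  qed
  moreover have "cmod (\<phi> x) \<le> 1 * opnorm k x" if "x \<in> Sspace" for x
  proof -
    have "closure (state_hull k) \<subseteq> {\<phi>. cmod (\<phi> x) \<le> 1 * opnorm k x}"
      using state_hull_bound[OF _ that]
      by (intro closure_minimal closed_Collect_le continuous_intros) auto
    then show ?thesis using \<phi> by blast
  qed
  ultimately show ?thesis unfolding Sdual_def by blast
qed

text \<open>The approximation clause of \<open>nstate\<close> runs over basic neighbourhoods of the
  topology of pointwise convergence on \<open>Sspace\<close>, and each of them meets the
  hull.\<close>

lemma closure_state_hull_nstate:
  assumes \<phi>: "\<phi> \<in> closure (state_hull k)"
  shows "nstate k \<phi>"
  unfolding nstate_def
proof (intro conjI allI impI closure_state_hull_in_Sdual[OF \<phi>])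
  fix F and \<epsilon> :: real assume F: "finite F \<and> F \<subseteq> Sspace \<and> \<epsilon> > 0"
  let ?U = "\<Inter>x\<in>F. {\<psi>::op \<Rightarrow> complex. cmod (\<phi> x - \<psi> x) < \<epsilon>}"
  have "open ?U"
    using F by (intro open_INT ballI open_Collect_less continuous_intros) auto
  moreover have "\<phi> \<in> ?U" using F by auto
  ultimately obtain \<psi> where \<psi>: "\<psi> \<in> state_hull k" "\<psi> \<in> ?U"
    using \<phi> unfolding closure_iff_nhds_not_empty by blast
  obtain m :: nat and t \<xi> where 1: "\<forall>i<m. t i \<ge> 0 \<and> \<xi> i \<in> dball k" "(\<Sum>i<m. t i) = (1::real)"
    and e: "\<psi> = (\<lambda>x. if x \<in> Sspace then \<Sum>i<m. complex_of_real (t i) * vstate (\<xi> i) x else 0)"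
    by (rule state_hullE[OF \<psi>(1)])
  have "\<forall>x\<in>F. cmod (\<phi> x - (\<Sum>i<m. complex_of_real (t i) * vstate (\<xi> i) x)) < \<epsilon>"
  proof
    fix x assume x: "x \<in> F"
    then have "\<psi> x = (\<Sum>i<m. complex_of_real (t i) * vstate (\<xi> i) x)" using F by (auto simp: e)
    then show "cmod (\<phi> x - (\<Sum>i<m. complex_of_real (t i) * vstate (\<xi> i) x)) < \<epsilon>" using \<psi>(2) x by auto
  qed
  with 1 show "\<exists>k' (t::nat \<Rightarrow> real) \<xi>. (\<forall>i<k'. t i \<ge> 0 \<and> \<xi> i \<in> dball k) \<and> (\<Sum>i<k'. t i) = 1 \<and>
      (\<forall>x\<in>F. cmod (\<phi> x - (\<Sum>i<k'. complex_of_real (t i) * vstate (\<xi> i) x)) < \<epsilon>)"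
    by (intro exI[of _ m] exI[of _ t] exI[of _ \<xi>] conjI)
qed

section \<open>A faithful state\<close>

definition scaled_unitv :: "nat \<Rightarrow> nat \<Rightarrow> seq" where
  "scaled_unitv k i = (\<lambda>j. complex_of_real (real (Suc i) ^ k) * unitv i j)"

lemma scaled_unitv_in_dball: "scaled_unitv k i \<in> dball k"
proof -
  have "(\<lambda>j. (cmod (scaled_unitv k i j))\<^sup>2 / real (Suc j) ^ (2*k)) = (\<lambda>j. if j = i then 1 else 0)"
    by (auto simp: scaled_unitv_def unitv_def norm_power power_mult_distrib power_mult[symmetric] mult.commute simp del: of_nat_Suc)
  then show ?thesis
    using sums_single[of i "\<lambda>_. 1::real"] by (auto simp: dball_def sdnorm_def sums_iff)
qed

text \<open>An infinite convex combination in which every normalised unit vector has positive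
  weight, so the value on \<open>opmult (adj x) x\<close> can vanish only if all columns of
  \<open>x\<close> do.\<close>

definition faithful_state :: "nat \<Rightarrow> op \<Rightarrow> complex" where
  "faithful_state k x = (\<Sum>i. complex_of_real ((1/2) ^ Suc i) * vstate (scaled_unitv k i) x)"

lemma faithful_state_sums:
  assumes "x \<in> Sspace"
  shows "(\<lambda>i. complex_of_real ((1/2) ^ Suc i) * vstate (scaled_unitv k i) x) sums faithful_state k x"
    and "cmod (faithful_state k x) \<le> opnorm k x"
proof -
  have g: "(\<lambda>i. (1/2) ^ Suc i * opnorm k x) sums (1 * opnorm k x)"
    by (intro sums_mult2 power_half_series)
  have le: "cmod (complex_of_real ((1/2) ^ Suc i) * vstate (scaled_unitv k i) x) \<le> (1/2) ^ Suc i * opnorm k x" for i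
    unfolding norm_mult norm_of_real using vstate_bound[OF assms scaled_unitv_in_dball, of k i]
    by (simp add: mult_left_mono)
  have s: "summable (\<lambda>i. cmod (complex_of_real ((1/2) ^ Suc i) * vstate (scaled_unitv k i) x))"
    by (rule summable_comparison_test'[OF sums_summable[OF g]]) (use le in simp)
  show "(\<lambda>i. complex_of_real ((1/2) ^ Suc i) * vstate (scaled_unitv k i) x) sums faithful_state k x"
    unfolding faithful_state_def by (rule summable_sums[OF summable_norm_cancel[OF s]])
  have "cmod (faithful_state k x) \<le> (\<Sum>i. cmod (complex_of_real ((1/2) ^ Suc i) * vstate (scaled_unitv k i) x))"
    unfolding faithful_state_def by (rule summable_norm[OF s])
  also have "\<dots> \<le> opnorm k x"
    using suminf_le[OF le s sums_summable[OF g]] sums_unique[OF g] by simp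
  finally show "cmod (faithful_state k x) \<le> opnorm k x" .
qed

text \<open>Verified directly instead of through \<open>closure_state_hull_nstate\<close>, because
  this functional is not cut off outside \<open>Sspace\<close>; partial sums of the series give the
  approximating combinations.\<close>

lemma nstate_faithful_state: "nstate k (faithful_state k)"
  unfolding nstate_def
proof (intro conjI allI impI)
  have sd: "scaled_unitv k i \<in> sdual" for i using scaled_unitv_in_dball dball_subset_sdual by blast
  have "faithful_state k (\<lambda>\<xi> i. a * x \<xi> i + b * y \<xi> i) = a * faithful_state k x + b * faithful_state k y"
    if "x \<in> Sspace" "y \<in> Sspace" for x y a b
  proof -
    have "(\<lambda>i. a * (complex_of_real ((1/2) ^ Suc i) * vstate (scaled_unitv k i) x)
        + b * (complex_of_real ((1/2) ^ Suc i) * vstate (scaled_unitv k i) y))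
        sums (a * faithful_state k x + b * faithful_state k y)"
      by (intro sums_add sums_mult faithful_state_sums that)
    moreover have "a * (complex_of_real ((1/2) ^ Suc i) * vstate (scaled_unitv k i) x)
        + b * (complex_of_real ((1/2) ^ Suc i) * vstate (scaled_unitv k i) y)
        = complex_of_real ((1/2) ^ Suc i) * vstate (scaled_unitv k i) (\<lambda>\<xi> i. a * x \<xi> i + b * y \<xi> i)" for i
      unfolding vstate_lincomb[OF that sd] by (simp add: algebra_simps)
    ultimately have "(\<lambda>i. complex_of_real ((1/2) ^ Suc i) * vstate (scaled_unitv k i) (\<lambda>\<xi> i. a * x \<xi> i + b * y \<xi> i))
        sums (a * faithful_state k x + b * faithful_state k y)"
      by (simp only:)
    then show ?thesis unfolding faithful_state_def[of k "\<lambda>\<xi> i. a * x \<xi> i + b * y \<xi> i"]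
      by (rule sums_unique[symmetric])
  qed
  moreover have "\<forall>x\<in>Sspace. cmod (faithful_state k x) \<le> 1 * opnorm k x"
    using faithful_state_sums(2) by simp
  ultimately show "faithful_state k \<in> Sdual" unfolding Sdual_def by blast
next
  fix F and \<epsilon> :: real assume F: "finite F \<and> F \<subseteq> Sspace \<and> \<epsilon> > 0"
  let ?p = "\<lambda>N x. \<Sum>i<N. complex_of_real ((1/2) ^ Suc i) * vstate (scaled_unitv k i) x"
  have "eventually (\<lambda>N. \<forall>x\<in>F. dist (?p N x) (faithful_state k x) < \<epsilon>) sequentially"
    using F faithful_state_sums(1)[where k=k] unfolding sums_def
    by (intro eventually_ball_finite ballI tendstoD) auto
  then obtain N where N: "\<forall>x\<in>F. dist (?p N x) (faithful_state k x) < \<epsilon>"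
    by (auto simp: eventually_sequentially)
  \<comment> \<open>The missing mass of the truncated series is put on the zero vector.\<close>
  define t where "t i = (if i < N then (1/2) ^ Suc i else 1 - (\<Sum>i<N. (1/2) ^ Suc i :: real))" for i
  define \<xi> where "\<xi> i = (if i < N then scaled_unitv k i else (\<lambda>j. 0))" for i
  have "(\<Sum>i<N. (1/2) ^ Suc i :: real) \<le> 1"
    using sum_le_suminf[OF sums_summable[OF power_half_series], of "{..<N}"] sums_unique[OF power_half_series] by simp
  then have "\<forall>i<Suc N. t i \<ge> 0 \<and> \<xi> i \<in> dball k"
    by (auto simp: t_def \<xi>_def scaled_unitv_in_dball zero_in_dball)
  moreover have "(\<Sum>i<Suc N. t i) = 1" by (simp add: t_def)
  moreover have "\<forall>x\<in>F. cmod (faithful_state k x - (\<Sum>i<Suc N. complex_of_real (t i) * vstate (\<xi> i) x)) < \<epsilon>"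
  proof
    fix x assume x: "x \<in> F"
    then have "vstate (\<xi> N) x = 0" using F vstate_zero by (auto simp: \<xi>_def)
    then have "(\<Sum>i<Suc N. complex_of_real (t i) * vstate (\<xi> i) x) = ?p N x"
      by (simp add: t_def \<xi>_def)
    then show "cmod (faithful_state k x - (\<Sum>i<Suc N. complex_of_real (t i) * vstate (\<xi> i) x)) < \<epsilon>"
      using N x by (simp add: dist_norm norm_minus_commute)
  qed
  ultimately show "\<exists>k' (t::nat \<Rightarrow> real) \<xi>. (\<forall>i<k'. t i \<ge> 0 \<and> \<xi> i \<in> dball k) \<and> (\<Sum>i<k'. t i) = 1 \<and>
      (\<forall>x\<in>F. cmod (faithful_state k x - (\<Sum>i<k'. complex_of_real (t i) * vstate (\<xi> i) x)) < \<epsilon>)"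
    by (intro exI[of _ "Suc N"] exI[of _ t] exI[of _ \<xi>] conjI)
qed

lemma Re_faithful_state_nonneg:
  assumes "A \<in> Sspace" "\<And>\<xi>. \<xi> \<in> dball k \<Longrightarrow> 0 \<le> Re (vstate \<xi> A)"
  shows "0 \<le> Re (faithful_state k A)"
proof -
  have "(\<lambda>i. (1/2) ^ Suc i * Re (vstate (scaled_unitv k i) A)) sums Re (faithful_state k A)"
    using sums_Re[OF faithful_state_sums(1)[OF assms(1)]] by (simp only: Re_complex_of_real complex.sel times_complex.simps Im_complex_of_real mult_zero_left diff_zero)
  from sums_le[OF _ sums_zero this] show ?thesis
    using assms(2)[OF scaled_unitv_in_dball] by simp
qed

lemma Re_faithful_state_adj_mult_pos:
  assumes x: "x \<in> Sspace" and nz: "x \<noteq> (\<lambda>\<xi> i. 0)"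
  shows "0 < Re (faithful_state k (opmult (adj x) x))"
proof -
  let ?A = "opmult (adj x) x"
  have sd: "scaled_unitv k i \<in> sdual" for i using scaled_unitv_in_dball dball_subset_sdual by blast
  obtain j where j: "x (unitv j) \<noteq> (\<lambda>i. 0)" using op_eq_zero_of_unitv[OF x] nz by blast
  have "x (scaled_unitv k j) \<noteq> (\<lambda>i. 0)"
    unfolding scaled_unitv_def Sspace_scale[OF x unitv_in_sdual] using j by (auto simp: fun_eq_iff simp del: of_nat_Suc)
  then have pos: "0 < Re (vstate (scaled_unitv k j) ?A)"
    unfolding vstate_def pairing_adj_mult[OF x sd sd] by (intro Re_pairing_self_pos Sspace_sspace x)
  have s: "(\<lambda>i. (1/2) ^ Suc i * Re (vstate (scaled_unitv k i) ?A)) sums Re (faithful_state k ?A)"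
    using sums_Re[OF faithful_state_sums(1)[OF adj_mult_in_Sspace[OF x]]] by simp
  show ?thesis
    unfolding sums_unique[OF s]
    using pos Re_vstate_adj_mult_nonneg[OF x sd]
    by (intro suminf_pos2[OF sums_summable[OF s], of j]) (auto intro!: mult_nonneg_nonneg mult_pos_pos)
qed

section \<open>Concave-like minimax\<close>

text \<open>Separation of two convex sets in the plane: pairs lying below some value
  \<open>(g x, h x)\<close>, and the open positive quadrant. The normal of the separating line,
  rescaled, gives the multipliers.\<close>

lemma two_concavelike_alternative:
  fixes g h :: "'a \<Rightarrow> real"
  assumes conv: "\<And>x y t. x \<in> X \<Longrightarrow> y \<in> X \<Longrightarrow> 0 \<le> t \<Longrightarrow> t \<le> 1 \<Longrightarrow>
      \<exists>z\<in>X. (1 - t) * g x + t * g y \<le> g z \<and> (1 - t) * h x + t * h y \<le> h z"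
    and no: "\<And>x. x \<in> X \<Longrightarrow> \<not> (g x > 0 \<and> h x > 0)"
  shows "\<exists>a b. a \<ge> 0 \<and> b \<ge> 0 \<and> a + b = 1 \<and> (\<forall>x\<in>X. a * g x + b * h x \<le> 0)"
proof (cases "X = {}")
  \<comment> \<open>Occurs in the induction that follows, where the domain shrinks to a possibly
    empty subset.\<close>
  case True
  then show ?thesis by (intro exI[of _ 1] exI[of _ 0]) auto
next
  case False
  then obtain x0 where x0: "x0 \<in> X" by blast
  \<comment> \<open>The image of \<open>X\<close> need not be convex; closing it downwards makes it
    so, because \<open>conv\<close> only provides a point that dominates the convex
    combination.\<close>
  define W where "W = {p. \<exists>x\<in>X. fst p \<le> g x \<and> snd p \<le> h x}"
  define P where "P = {p::real \<times> real. fst p > 0 \<and> snd p > 0}"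
  have "convex W"
    unfolding convex_alt
  proof (intro ballI allI impI)
    fix p q t assume p: "p \<in> W" and q: "q \<in> W" and t: "0 \<le> t \<and> t \<le> (1::real)"
    obtain x y where x: "x \<in> X" "fst p \<le> g x" "snd p \<le> h x" and y: "y \<in> X" "fst q \<le> g y" "snd q \<le> h y"
      using p q unfolding W_def by blast
    obtain z where z: "z \<in> X" "(1 - t) * g x + t * g y \<le> g z" "(1 - t) * h x + t * h y \<le> h z"
      using conv[OF x(1) y(1)] t by blast
    have "(1 - t) * fst p + t * fst q \<le> (1 - t) * g x + t * g y"
      "(1 - t) * snd p + t * snd q \<le> (1 - t) * h x + t * h y"
      using x y t by (auto intro!: add_mono mult_left_mono)
    then show "(1 - t) *\<^sub>R p + t *\<^sub>R q \<in> W"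
      unfolding W_def using z by (auto intro!: bexI[of _ z])
  qed
  moreover have "convex P"
    unfolding convex_alt P_def
  proof (intro ballI allI impI)
    fix p q :: "real \<times> real" and t :: real
    assume "p \<in> {p. 0 < fst p \<and> 0 < snd p}" "q \<in> {p. 0 < fst p \<and> 0 < snd p}" "0 \<le> t \<and> t \<le> 1"
    then show "(1 - t) *\<^sub>R p + t *\<^sub>R q \<in> {p. 0 < fst p \<and> 0 < snd p}"
      by (cases "t = 0") (auto intro!: add_nonneg_pos)
  qed
  moreover have "W \<noteq> {}" "P \<noteq> {}"
  proof -
    have "(g x0, h x0) \<in> W" using x0 by (auto simp: W_def)
    moreover have "(1, 1) \<in> P" by (simp add: P_def)
    ultimately show "W \<noteq> {}" "P \<noteq> {}" by blast+
  qed
  moreover have "W \<inter> P = {}"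
    using no by (auto simp: W_def P_def) (meson less_le_trans)
  ultimately obtain c r where c: "c \<noteq> 0" and cW: "\<And>p. p \<in> W \<Longrightarrow> inner c p \<le> r" and cP: "\<And>p. p \<in> P \<Longrightarrow> inner c p \<ge> r"
    using separating_hyperplane_sets[of W P] by metis
  obtain a b where ab: "c = (a, b)" by (cases c)
  \<comment> \<open>The quadrant contains points \<open>(d, d)\<close> arbitrarily close to the
    origin.\<close>
  have r: "r \<le> 0"
  proof (rule field_le_epsilon)
    fix e :: real assume "e > 0"
    define d where "d = e / (\<bar>a\<bar> + \<bar>b\<bar> + 1)"
    have d: "d > 0" using \<open>e > 0\<close> by (simp add: d_def add_nonneg_pos)
    then have "(d, d) \<in> P" by (simp add: P_def)
    from cP[OF this] have "r \<le> (a + b) * d" by (simp add: ab distrib_right)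
    also have "\<dots> \<le> (\<bar>a\<bar> + \<bar>b\<bar> + 1) * d" using d by (intro mult_right_mono) auto
    also have "\<dots> = e" by (simp add: d_def add_nonneg_pos less_imp_neq[symmetric])
    finally show "r \<le> 0 + e" by simp
  qed
  have "a \<ge> 0"
  proof (rule ccontr)
    assume a: "\<not> a \<ge> 0"
    \<comment> \<open>As \<open>W\<close> is closed downwards, its first coordinate can be made very
      negative. The first entry of the maximum keeps the point in \<open>W\<close>; the second makes
      a negative \<open>a\<close> exceed the bound \<open>r\<close> by one.\<close>
    define M where "M = max (- g x0) ((r - b * h x0 + 1) / (- a))"
    have "(- M, h x0) \<in> W" using x0 by (auto simp: W_def M_def intro!: bexI[of _ x0])
    from cW[OF this] have "(- a) * M \<le> r - b * h x0" by (simp add: ab)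
    moreover have "(- a) * M \<ge> (- a) * ((r - b * h x0 + 1) / (- a))"
      using a by (intro mult_left_mono) (auto simp: M_def)
    ultimately show False using a by simp
  qed
  moreover have "b \<ge> 0"
  proof (rule ccontr)
    assume b: "\<not> b \<ge> 0"
    define M where "M = max (- h x0) ((r - a * g x0 + 1) / (- b))"
    have "(g x0, - M) \<in> W" using x0 by (auto simp: W_def M_def intro!: bexI[of _ x0])
    from cW[OF this] have "(- b) * M \<le> r - a * g x0" by (simp add: ab)
    moreover have "(- b) * M \<ge> (- b) * ((r - a * g x0 + 1) / (- b))"
      using b by (intro mult_left_mono) (auto simp: M_def)
    ultimately show False using b by simp
  qed
  moreover have "a \<noteq> 0 \<or> b \<noteq> 0" using c ab by (simp add: zero_prod_def)
  ultimately have s: "a + b > 0" "a \<ge> 0" "b \<ge> 0" by auto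
  show ?thesis
  proof (intro exI conjI ballI)
    show "a / (a + b) \<ge> 0" "b / (a + b) \<ge> 0" "a / (a + b) + b / (a + b) = 1"
      using s by (simp_all add: add_divide_distrib[symmetric])
    fix x assume "x \<in> X"
    then have "(g x, h x) \<in> W" by (auto simp: W_def)
    from cW[OF this] r have "(a * g x + b * h x) / (a + b) \<le> 0"
      using s by (intro divide_nonpos_pos) (auto simp: ab)
    then show "a / (a + b) * g x + b / (a + b) * h x \<le> 0" by (simp add: add_divide_distrib)
  qed
qed

text \<open>Induction on the index set. Where \<open>f j\<close> is positive, which is again a
  concave-like domain, the other functions are never all positive, so multipliers exist for them
  there. They merge these functions into one, and the two-function case adds
  \<open>f j\<close>.\<close>

lemma finite_concavelike_alternative:
  fixes f :: "'i \<Rightarrow> 'a \<Rightarrow> real"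
  assumes "finite I" "I \<noteq> {}"
    and "\<And>x y t. x \<in> X \<Longrightarrow> y \<in> X \<Longrightarrow> 0 \<le> t \<Longrightarrow> t \<le> 1 \<Longrightarrow>
      \<exists>z\<in>X. \<forall>i\<in>I. (1 - t) * f i x + t * f i y \<le> f i z"
    and "\<not> (\<exists>x\<in>X. \<forall>i\<in>I. f i x > 0)"
  shows "\<exists>l. (\<forall>i\<in>I. l i \<ge> 0) \<and> sum l I = 1 \<and> (\<forall>x\<in>X. (\<Sum>i\<in>I. l i * f i x) \<le> 0)"
  using assms
proof (induction I arbitrary: X rule: finite_ne_induct)
  case (singleton i)
  then show ?case by (intro exI[of _ "\<lambda>_. 1"]) (auto simp: not_less)
next
  case (insert j I)
  define X' where "X' = {x \<in> X. f j x > 0}"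
  have "\<exists>l. (\<forall>i\<in>I. l i \<ge> 0) \<and> sum l I = 1 \<and> (\<forall>x\<in>X'. (\<Sum>i\<in>I. l i * f i x) \<le> 0)"
  proof (rule insert.IH)
    fix x y t assume x: "x \<in> X'" and y: "y \<in> X'" and t: "0 \<le> t" "t \<le> (1::real)"
    then obtain z where z: "z \<in> X" "\<forall>i\<in>insert j I. (1 - t) * f i x + t * f i y \<le> f i z"
      using insert.prems(1)[of x y t] by (auto simp: X'_def)
    have "(1 - t) * f j x + t * f j y > 0"
      using x y t by (cases "t = 0") (auto simp: X'_def intro!: add_nonneg_pos)
    then have "z \<in> X'" using z by (auto simp: X'_def)
    then show "\<exists>z\<in>X'. \<forall>i\<in>I. (1 - t) * f i x + t * f i y \<le> f i z" using z by blast
  qed (use insert.prems(2) in \<open>auto simp: X'_def\<close>)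
  then obtain l where l: "\<And>i. i \<in> I \<Longrightarrow> l i \<ge> 0" "sum l I = 1" "\<And>x. x \<in> X' \<Longrightarrow> (\<Sum>i\<in>I. l i * f i x) \<le> 0"
    by blast
  have "\<exists>a b. a \<ge> 0 \<and> b \<ge> 0 \<and> a + b = 1 \<and> (\<forall>x\<in>X. a * (\<Sum>i\<in>I. l i * f i x) + b * f j x \<le> 0)"
  proof (rule two_concavelike_alternative)
    fix x y t assume "x \<in> X" "y \<in> X" "0 \<le> t" "t \<le> (1::real)"
    then obtain z where z: "z \<in> X" "\<forall>i\<in>insert j I. (1 - t) * f i x + t * f i y \<le> f i z"
      using insert.prems(1)[of x y t] by auto
    have "(1 - t) * (\<Sum>i\<in>I. l i * f i x) + t * (\<Sum>i\<in>I. l i * f i y)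
        = (\<Sum>i\<in>I. l i * ((1 - t) * f i x + t * f i y))"
      by (simp add: sum_distrib_left sum.distrib[symmetric] algebra_simps)
    also have "\<dots> \<le> (\<Sum>i\<in>I. l i * f i z)"
      using z l(1) by (intro sum_mono mult_left_mono) auto
    finally show "\<exists>z\<in>X. (1 - t) * (\<Sum>i\<in>I. l i * f i x) + t * (\<Sum>i\<in>I. l i * f i y) \<le> (\<Sum>i\<in>I. l i * f i z)
        \<and> (1 - t) * f j x + t * f j y \<le> f j z" using z by blast
  qed (use l(3) in \<open>force simp: X'_def\<close>)
  then obtain a b where ab: "a \<ge> 0" "b \<ge> 0" "a + b = 1" "\<And>x. x \<in> X \<Longrightarrow> a * (\<Sum>i\<in>I. l i * f i x) + b * f j x \<le> 0"
    by blast
  define l' where "l' i = (if i = j then b else a * l i)" for i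
  have I: "(\<Sum>i\<in>I. l' i * c i) = a * (\<Sum>i\<in>I. l i * c i)" for c :: "'i \<Rightarrow> real"
    unfolding sum_distrib_left using insert.hyps(3) by (intro sum.cong) (auto simp: l'_def)
  have j: "l' j = b" by (simp add: l'_def)
  show ?case
  proof (intro exI conjI ballI)
    show "sum l' (insert j I) = 1"
      using I[of "\<lambda>_. 1"] l(2) ab(3) insert.hyps by (simp add: j)
    show "(\<Sum>i\<in>insert j I. l' i * f i x) \<le> 0" if "x \<in> X" for x
      using ab(4)[OF that] insert.hyps by (simp add: I j)
  qed (use ab l(1) in \<open>auto simp: l'_def\<close>)
qed

text \<open>By compactness only finitely many conditions have to be met at a time. If that were
  impossible, the finite alternative would produce multipliers whose weighted average contradicts
  \<open>av\<close>.\<close>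

lemma compact_concavelike_minimax:
  fixes f :: "'i \<Rightarrow> 'a::topological_space \<Rightarrow> real"
  assumes X: "compact X" "X \<noteq> {}" and cont: "\<And>i. i \<in> I \<Longrightarrow> continuous_on UNIV (f i)"
    and conv: "\<And>x y t. x \<in> X \<Longrightarrow> y \<in> X \<Longrightarrow> 0 \<le> t \<Longrightarrow> t \<le> 1 \<Longrightarrow>
      \<exists>z\<in>X. \<forall>i\<in>I. (1 - t) * f i x + t * f i y \<le> f i z"
    and av: "\<And>J l e. finite J \<Longrightarrow> J \<subseteq> I \<Longrightarrow> (\<And>i. i \<in> J \<Longrightarrow> l i \<ge> 0) \<Longrightarrow> sum l J = 1 \<Longrightarrow> e > 0 \<Longrightarrow>
      \<exists>x\<in>X. (\<Sum>i\<in>J. l i * f i x) > - e"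
  shows "\<exists>x\<in>X. \<forall>i\<in>I. f i x \<ge> 0"
proof -
  \<comment> \<open>The second component is a tolerance: the hypothesis on averages holds only up to
    \<open>e\<close>, so finite families are solved approximately and the tolerance is sent to zero
    after the intersection.\<close>
  define C where "C p = {x. - snd p \<le> f (fst p) x}" for p :: "'i \<times> real"
  have "X \<inter> \<Inter> (C ` (I \<times> {0<..})) \<noteq> {}"
  proof (rule compact_imp_fip[OF X(1)])
    show "closed T" if "T \<in> C ` (I \<times> {0<..})" for T
      using that unfolding C_def by (auto intro!: closed_Collect_le cont continuous_on_const)
    fix F' assume "finite F'" "F' \<subseteq> C ` (I \<times> {0<..})"
    then obtain K where K: "finite K" "K \<subseteq> I \<times> {0<..}" "F' = C ` K"
      by (meson finite_subset_image)
    show "X \<inter> \<Inter> F' \<noteq> {}"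
    proof (cases "K = {}")
      case True
      then show ?thesis using K X by simp
    next
      case False
      define e where "e = Min (snd ` K)"
      have e: "e > 0" "\<And>p. p \<in> K \<Longrightarrow> e \<le> snd p"
        using K False by (auto simp: e_def)
      have "\<exists>x\<in>X. \<forall>i\<in>fst ` K. f i x + e > 0"
      proof (rule ccontr)
        assume no: "\<not> ?thesis"
        have "\<exists>l. (\<forall>i\<in>fst ` K. l i \<ge> 0) \<and> sum l (fst ` K) = 1 \<and> (\<forall>x\<in>X. (\<Sum>i\<in>fst ` K. l i * (f i x + e)) \<le> 0)"
        proof (rule finite_concavelike_alternative[OF _ _ _ no])
          fix x y t assume "x \<in> X" "y \<in> X" "0 \<le> t" "t \<le> (1::real)"
          then obtain z where "z \<in> X" "\<forall>i\<in>I. (1 - t) * f i x + t * f i y \<le> f i z"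
            using conv by blast
          moreover have "fst ` K \<subseteq> I" using K by auto
          ultimately show "\<exists>z\<in>X. \<forall>i\<in>fst ` K. (1 - t) * (f i x + e) + t * (f i y + e) \<le> f i z + e"
            by (intro bexI[of _ z]) (auto simp: algebra_simps)
        qed (use K False in auto)
        then obtain l where l: "\<And>i. i \<in> fst ` K \<Longrightarrow> l i \<ge> 0" "sum l (fst ` K) = 1"
          "\<And>x. x \<in> X \<Longrightarrow> (\<Sum>i\<in>fst ` K. l i * (f i x + e)) \<le> 0" by blast
        have "fst ` K \<subseteq> I" "finite (fst ` K)" using K by auto
        with av[OF _ _ l(1,2) e(1)] obtain x where x: "x \<in> X" "(\<Sum>i\<in>fst ` K. l i * f i x) > - e" by blast
        have "(\<Sum>i\<in>fst ` K. l i * (f i x + e)) = (\<Sum>i\<in>fst ` K. l i * f i x) + e"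
          using l(2) by (simp add: distrib_left sum.distrib sum_distrib_right[symmetric])
        with l(3)[OF x(1)] x(2) show False by simp
      qed
      then obtain x where x: "x \<in> X" "\<And>p. p \<in> K \<Longrightarrow> f (fst p) x + e > 0" by auto
      have "x \<in> C p" if "p \<in> K" for p
        using x(2)[OF that] e(2)[OF that] by (simp add: C_def)
      with x(1) show ?thesis unfolding K(3) by blast
    qed
  qed
  then obtain x where x: "x \<in> X" "\<And>p. p \<in> I \<times> {0<..} \<Longrightarrow> x \<in> C p" by blast
  have "f i x \<ge> 0" if "i \<in> I" for i
  proof (rule field_le_epsilon)
    fix e :: real assume "e > 0"
    with x(2)[of "(i, e)"] that show "0 \<le> f i x + e" by (simp add: C_def)
  qed
  with x(1) show ?thesis by blast
qed

section \<open>Bilinear forms and states\<close>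

lemma
  assumes "contbil u" "x \<in> Sspace" "x' \<in> Sspace" "y \<in> Sspace"
  shows contbil_lincomb_left: "u (\<lambda>\<xi> i. a * x \<xi> i + b * x' \<xi> i) y = a * u x y + b * u x' y"
    and contbil_lincomb_right: "u y (\<lambda>\<xi> i. a * x \<xi> i + b * x' \<xi> i) = a * u y x + b * u y x'"
  using assms unfolding contbil_def by blast+

lemma contbil_scale:
  assumes "contbil u" "x \<in> Sspace" "y \<in> Sspace"
  shows "u (\<lambda>\<xi> i. a * x \<xi> i) (\<lambda>\<xi> i. b * y \<xi> i) = a * b * u x y"
proof -
  have "u (\<lambda>\<xi> i. a * x \<xi> i) (\<lambda>\<xi> i. b * y \<xi> i) = a * u x (\<lambda>\<xi> i. b * y \<xi> i)"
    using contbil_lincomb_left[OF assms(1,2,2) Sspace_scale_closed[OF assms(3)], of a 0] by simp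
  also have "u x (\<lambda>\<xi> i. b * y \<xi> i) = b * u x y"
    using contbil_lincomb_right[OF assms(1,3,3,2), of b 0] by simp
  finally show ?thesis by simp
qed

lemma
  assumes x: "x \<in> Sspace"
  shows adj_mult_scale: "opmult (adj (\<lambda>\<xi> i. c * x \<xi> i)) (\<lambda>\<xi> i. c * x \<xi> i)
      = (\<lambda>\<xi> i. complex_of_real ((cmod c)\<^sup>2) * opmult (adj x) x \<xi> i)"
    and mult_adj_scale: "opmult (\<lambda>\<xi> i. c * x \<xi> i) (adj (\<lambda>\<xi> i. c * x \<xi> i))
      = (\<lambda>\<xi> i. complex_of_real ((cmod c)\<^sup>2) * opmult x (adj x) \<xi> i)"
proof -
  have d: "x \<xi> \<in> sdual" "adj x \<xi> \<in> sdual" for \<xi>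
    using Sspace_sspace[OF x] Sspace_sspace[OF adj_in_Sspace[OF x]] sspace_subset_sdual by blast+
  show "opmult (adj (\<lambda>\<xi> i. c * x \<xi> i)) (\<lambda>\<xi> i. c * x \<xi> i)
      = (\<lambda>\<xi> i. complex_of_real ((cmod c)\<^sup>2) * opmult (adj x) x \<xi> i)"
    unfolding adj_scale[OF x] opmult_def complex_norm_square
    by (simp only: Sspace_scale[OF adj_in_Sspace[OF x] d(1)] mult_ac)
  show "opmult (\<lambda>\<xi> i. c * x \<xi> i) (adj (\<lambda>\<xi> i. c * x \<xi> i))
      = (\<lambda>\<xi> i. complex_of_real ((cmod c)\<^sup>2) * opmult x (adj x) \<xi> i)"
    unfolding adj_scale[OF x] opmult_def complex_norm_square
    by (simp only: Sspace_scale[OF x d(2)] mult_ac)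
qed

lemma rcnorm_power2:
  assumes "\<And>j. j < m \<Longrightarrow> xs j \<in> Sspace"
  shows "(rcnorm k m xs)\<^sup>2 = max (opnorm k (opsum m (\<lambda>j. opmult (adj (xs j)) (xs j))))
      (opnorm k (opsum m (\<lambda>j. opmult (xs j) (adj (xs j)))))"
    and "0 \<le> rcnorm k m xs"
proof -
  have "0 \<le> opnorm k (opsum m (\<lambda>j. opmult (adj (xs j)) (xs j)))"
    "0 \<le> opnorm k (opsum m (\<lambda>j. opmult (xs j) (adj (xs j))))"
    using assms by (auto intro!: opnorm_nonneg opsum_in_Sspace adj_mult_in_Sspace mult_adj_in_Sspace)
  then show "(rcnorm k m xs)\<^sup>2 = max (opnorm k (opsum m (\<lambda>j. opmult (adj (xs j)) (xs j))))
      (opnorm k (opsum m (\<lambda>j. opmult (xs j) (adj (xs j)))))" "0 \<le> rcnorm k m xs"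
    unfolding rcnorm_def by (simp_all add: max_def)
qed

lemma vstate_scale:
  assumes "x \<in> Sspace" "\<xi> \<in> sdual"
  shows "vstate \<xi> (\<lambda>\<xi> i. a * x \<xi> i) = a * vstate \<xi> x"
  using vstate_lincomb[OF assms(1,1,2), of a 0] by simp

text \<open>The two vectors vary independently, so the suprema can be taken one after the
  other.\<close>

lemma positive_op_opnorm_add_le:
  assumes P: "positive_op P" and Q: "positive_op Q"
    and le: "\<And>\<xi> \<eta>. \<xi> \<in> dball k \<Longrightarrow> \<eta> \<in> dball k \<Longrightarrow> Re (vstate \<xi> P) + Re (vstate \<eta> Q) \<le> s"
  shows "opnorm k P + opnorm k Q \<le> s"
proof -
  have "opnorm k P \<le> s - Re (vstate \<eta> Q)" if "\<eta> \<in> dball k" for \<eta>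
    using le[OF _ that] by (intro positive_op_opnorm_le[OF P]) (simp add: le_diff_eq)
  then have "opnorm k Q \<le> s - opnorm k P"
    by (intro positive_op_opnorm_le[OF Q]) (simp add: le_diff_eq add.commute)
  then show ?thesis by simp
qed

text \<open>By contradiction: if all quadruples of vectors fell short by \<open>e\<close>, suprema
  would bound the sum of the squared row-column norms by \<open>2 * (U - e) / C\<close>, while
  \<open>hyp\<close> and the arithmetic-geometric mean inequality bound it below by
  \<open>2 * U / C\<close>. The slack \<open>e\<close> allows for suprema that are not
  attained.\<close>

lemma average_bound:
  assumes u: "contbil u" and C: "C > 0"
    and hyp: "\<forall>m xs ys. (\<forall>j<m. xs j \<in> Sspace \<and> ys j \<in> Sspace) \<longrightarrow>
      cmod (\<Sum>j<m. u (xs j) (ys j)) \<le> C * rcnorm k m xs * rcnorm k m ys"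
    and J: "finite J" "J \<subseteq> Sspace \<times> Sspace" and l: "\<forall>p\<in>J. l p \<ge> 0" and e: "e > 0"
  shows "\<exists>\<xi>1\<in>dball k. \<exists>\<xi>2\<in>dball k. \<exists>\<eta>1\<in>dball k. \<exists>\<eta>2\<in>dball k.
    (\<Sum>p\<in>J. l p * (C / 2 * (Re (vstate \<xi>1 (opmult (adj (fst p)) (fst p))) + Re (vstate \<xi>2 (opmult (fst p) (adj (fst p))))
      + Re (vstate \<eta>1 (opmult (adj (snd p)) (snd p))) + Re (vstate \<eta>2 (opmult (snd p) (adj (snd p)))))
      - cmod (u (fst p) (snd p)))) > - e"
proof (rule ccontr)
  assume "\<not> ?thesis"
  then have neg: "\<And>\<xi>1 \<xi>2 \<eta>1 \<eta>2. \<xi>1 \<in> dball k \<Longrightarrow> \<xi>2 \<in> dball k \<Longrightarrow> \<eta>1 \<in> dball k \<Longrightarrow> \<eta>2 \<in> dball k \<Longrightarrow>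
    (\<Sum>p\<in>J. l p * (C / 2 * (Re (vstate \<xi>1 (opmult (adj (fst p)) (fst p))) + Re (vstate \<xi>2 (opmult (fst p) (adj (fst p))))
      + Re (vstate \<eta>1 (opmult (adj (snd p)) (snd p))) + Re (vstate \<eta>2 (opmult (snd p) (adj (snd p)))))
      - cmod (u (fst p) (snd p)))) \<le> - e"
    by (meson not_less)
  define U where "U = (\<Sum>p\<in>J. l p * cmod (u (fst p) (snd p)))"
  obtain h m where h: "bij_betw h {..<m::nat} J"
    using ex_bij_betw_nat_finite[OF J(1)] by (metis atLeast0LessThan)
  have hJ: "h j \<in> J" if "j < m" for j using h that by (auto simp: bij_betw_def)
  have hS: "fst (h j) \<in> Sspace" "snd (h j) \<in> Sspace" and hl: "l (h j) \<ge> 0" if "j < m" for j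
    using hJ[OF that] J(2) l by (auto simp: mem_Times_iff)
  \<comment> \<open>A unimodular factor on the second argument turns each value of \<open>u\<close>
    into its modulus and cancels in the products with adjoints.\<close>
  define ph where "ph j = (if u (fst (h j)) (snd (h j)) = 0 then 1 else cnj (sgn (u (fst (h j)) (snd (h j)))))" for j
  have ph: "cmod (ph j) = 1" "ph j * u (fst (h j)) (snd (h j)) = complex_of_real (cmod (u (fst (h j)) (snd (h j))))" for j
  proof -
    show "cmod (ph j) = 1" by (simp add: ph_def norm_sgn)
    have "cnj (sgn z) * z = complex_of_real (cmod z)" if "z \<noteq> 0" for z
    proof -
      have "cnj (sgn z) * z = (z * cnj z) / complex_of_real (cmod z)"
        by (simp add: sgn_div_norm scaleR_conv_of_real field_simps)
      also have "\<dots> = complex_of_real (cmod z)"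
        using that by (simp add: complex_norm_square[symmetric] power2_eq_square)
      finally show ?thesis .
    qed
    then show "ph j * u (fst (h j)) (snd (h j)) = complex_of_real (cmod (u (fst (h j)) (snd (h j))))"
      by (simp add: ph_def)
  qed
  \<comment> \<open>A square root in each argument: \<open>u\<close> and the products with adjoints
    all acquire exactly the weight \<open>l\<close>.\<close>
  define c where "c j = complex_of_real (sqrt (l (h j)))" for j
  define xs where "xs j = (\<lambda>\<xi> i. c j * fst (h j) \<xi> i)" for j
  define ys where "ys j = (\<lambda>\<xi> i. (ph j * c j) * snd (h j) \<xi> i)" for j
  have S: "xs j \<in> Sspace" "ys j \<in> Sspace" if "j < m" for j
    unfolding xs_def ys_def using hS[OF that] by (simp_all only: Sspace_scale_closed)
  have c2: "(cmod (c j))\<^sup>2 = l (h j)" "(cmod (ph j * c j))\<^sup>2 = l (h j)" if "j < m" for j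
    using hl[OF that] by (simp_all add: c_def norm_mult ph(1))
  have "u (xs j) (ys j) = complex_of_real (l (h j) * cmod (u (fst (h j)) (snd (h j))))" if "j < m" for j
  proof -
    have "u (xs j) (ys j) = c j * (ph j * c j) * u (fst (h j)) (snd (h j))"
      unfolding xs_def ys_def by (rule contbil_scale[OF u hS[OF that]])
    also have "\<dots> = (c j * c j) * (ph j * u (fst (h j)) (snd (h j)))" by (simp only: mult_ac)
    also have "c j * c j = complex_of_real (l (h j))"
      unfolding c_def of_real_mult[symmetric] using hl[OF that] by simp
    finally show ?thesis by (simp add: ph(2))
  qed
  then have "(\<Sum>j<m. u (xs j) (ys j)) = complex_of_real (\<Sum>j<m. l (h j) * cmod (u (fst (h j)) (snd (h j))))"
    by simp
  also have "(\<Sum>j<m. l (h j) * cmod (u (fst (h j)) (snd (h j)))) = U"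
    unfolding U_def by (rule sum.reindex_bij_betw[OF h])
  finally have "U \<le> cmod (\<Sum>j<m. u (xs j) (ys j))" by simp
  also have "\<dots> \<le> C * rcnorm k m xs * rcnorm k m ys" using S by (intro hyp[rule_format]) auto
  finally have U: "U \<le> C * rcnorm k m xs * rcnorm k m ys" .
  define A where "A = opsum m (\<lambda>j. opmult (adj (xs j)) (xs j))"
  define B where "B = opsum m (\<lambda>j. opmult (xs j) (adj (xs j)))"
  define A' where "A' = opsum m (\<lambda>j. opmult (adj (ys j)) (ys j))"
  define B' where "B' = opsum m (\<lambda>j. opmult (ys j) (adj (ys j)))"
  have pos: "positive_op A" "positive_op B" "positive_op A'" "positive_op B'"
    unfolding A_def B_def A'_def B'_def
    using S by (simp_all add: positive_op_opsum positive_op_adj_mult positive_op_mult_adj)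
  have vs: "Re (vstate \<xi> A) = (\<Sum>p\<in>J. l p * Re (vstate \<xi> (opmult (adj (fst p)) (fst p))))"
    "Re (vstate \<xi> B) = (\<Sum>p\<in>J. l p * Re (vstate \<xi> (opmult (fst p) (adj (fst p)))))"
    "Re (vstate \<xi> A') = (\<Sum>p\<in>J. l p * Re (vstate \<xi> (opmult (adj (snd p)) (snd p))))"
    "Re (vstate \<xi> B') = (\<Sum>p\<in>J. l p * Re (vstate \<xi> (opmult (snd p) (adj (snd p)))))" if "\<xi> \<in> dball k" for \<xi>
  proof -
    have \<xi>: "\<xi> \<in> sdual" using that dball_subset_sdual by blast
    show "Re (vstate \<xi> A) = (\<Sum>p\<in>J. l p * Re (vstate \<xi> (opmult (adj (fst p)) (fst p))))"
      unfolding A_def sum.reindex_bij_betw[OF h, symmetric]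
      by (subst vstate_opsum[OF _ \<xi>])
        (auto simp: S adj_mult_in_Sspace xs_def adj_mult_scale hS c2 vstate_scale[OF _ \<xi>] Sspace_scale_closed simp del: of_real_power intro!: sum.cong)
    show "Re (vstate \<xi> B) = (\<Sum>p\<in>J. l p * Re (vstate \<xi> (opmult (fst p) (adj (fst p)))))"
      unfolding B_def sum.reindex_bij_betw[OF h, symmetric]
      by (subst vstate_opsum[OF _ \<xi>])
        (auto simp: S mult_adj_in_Sspace xs_def mult_adj_scale hS c2 vstate_scale[OF _ \<xi>] Sspace_scale_closed simp del: of_real_power intro!: sum.cong)
    show "Re (vstate \<xi> A') = (\<Sum>p\<in>J. l p * Re (vstate \<xi> (opmult (adj (snd p)) (snd p))))"
      unfolding A'_def sum.reindex_bij_betw[OF h, symmetric]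
      by (subst vstate_opsum[OF _ \<xi>])
        (auto simp: S adj_mult_in_Sspace ys_def adj_mult_scale hS c2 vstate_scale[OF _ \<xi>] Sspace_scale_closed simp del: of_real_power intro!: sum.cong)
    show "Re (vstate \<xi> B') = (\<Sum>p\<in>J. l p * Re (vstate \<xi> (opmult (snd p) (adj (snd p)))))"
      unfolding B'_def sum.reindex_bij_betw[OF h, symmetric]
      by (subst vstate_opsum[OF _ \<xi>])
        (auto simp: S mult_adj_in_Sspace ys_def mult_adj_scale hS c2 vstate_scale[OF _ \<xi>] Sspace_scale_closed simp del: of_real_power intro!: sum.cong)
  qed
  have all: "Re (vstate \<xi>1 A) + Re (vstate \<xi>2 B) + Re (vstate \<eta>1 A') + Re (vstate \<eta>2 B') \<le> 2 * (U - e) / C"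
    if d: "\<xi>1 \<in> dball k" "\<xi>2 \<in> dball k" "\<eta>1 \<in> dball k" "\<eta>2 \<in> dball k" for \<xi>1 \<xi>2 \<eta>1 \<eta>2
  proof -
    have "C / 2 * (Re (vstate \<xi>1 A) + Re (vstate \<xi>2 B) + Re (vstate \<eta>1 A') + Re (vstate \<eta>2 B')) - U \<le> - e"
      using neg[OF d] unfolding vs(1)[OF d(1)] vs(2)[OF d(2)] vs(3)[OF d(3)] vs(4)[OF d(4)] U_def
      by (simp add: sum_distrib_left sum.distrib sum_subtractf algebra_simps)
    then show ?thesis using C by (simp add: field_simps)
  qed
  have zero: "Re (vstate (\<lambda>i. 0) D) = 0" if "positive_op D" for D
    using that by (simp add: positive_op_def vstate_zero)
  note z = zero_in_dball[of k]
  \<comment> \<open>Zero vectors in two of the four places leave one norm for \<open>xs\<close> and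
    one for \<open>ys\<close>; the four choices together bound the sum of the two maxima.\<close>
  have "opnorm k P + opnorm k Q \<le> 2 * (U - e) / C" if "P = A \<or> P = B" "Q = A' \<or> Q = B'" for P Q
  proof (rule positive_op_opnorm_add_le)
    fix \<xi> \<eta> assume d: "\<xi> \<in> dball k" "\<eta> \<in> dball k"
    show "Re (vstate \<xi> P) + Re (vstate \<eta> Q) \<le> 2 * (U - e) / C"
      using that all[OF d(1) z d(2) z] all[OF d(1) z z d(2)] all[OF z d(1) d(2) z] all[OF z d(1) z d(2)]
      by (auto simp: zero pos)
  qed (use that pos in auto)
  from this[of A A'] this[of A B'] this[of B A'] this[of B B']
  have "max (opnorm k A) (opnorm k B) + max (opnorm k A') (opnorm k B') \<le> 2 * (U - e) / C" by auto
  then have "(rcnorm k m xs)\<^sup>2 + (rcnorm k m ys)\<^sup>2 \<le> 2 * (U - e) / C"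
    using S by (simp add: rcnorm_power2(1) A_def B_def A'_def B'_def)
  moreover have "2 * (rcnorm k m xs * rcnorm k m ys) \<le> (rcnorm k m xs)\<^sup>2 + (rcnorm k m ys)\<^sup>2"
    using sum_squares_bound[of "rcnorm k m xs" "rcnorm k m ys"] by simp
  ultimately have "2 * (rcnorm k m xs * rcnorm k m ys) \<le> 2 * (U - e) / C" by linarith
  then have "C * (rcnorm k m xs * rcnorm k m ys) \<le> U - e"
    using C by (simp add: field_simps)
  with U e show False by (simp add: mult.assoc)
qed

text \<open>The optimal scaling equates the two summands. It does not exist if \<open>a\<close> or
  \<open>b\<close> is zero, so both are shifted by \<open>d > 0\<close> and \<open>d\<close> is sent
  to zero.\<close>

lemma le_sqrt_mult_sqrt:
  fixes a b C v :: real
  assumes "C \<ge> 0" "a \<ge> 0" "b \<ge> 0" and le: "\<And>s. s > 0 \<Longrightarrow> v \<le> C / 2 * (s\<^sup>2 * a + b / s\<^sup>2)"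
  shows "v \<le> C * sqrt a * sqrt b"
proof -
  have *: "v \<le> C * sqrt (a + d) * sqrt (b + d)" if d: "d > 0" for d
  proof -
    define p where "p = sqrt (a + d)"
    define q where "q = sqrt (b + d)"
    have pq: "p > 0" "q > 0" "p\<^sup>2 = a + d" "q\<^sup>2 = b + d" using assms(2,3) d by (simp_all add: p_def q_def)
    \<comment> \<open>With \<open>s\<^sup>2 = q / p\<close> both summands become
      \<open>p * q\<close>.\<close>
    define s where "s = sqrt (q / p)"
    have s: "s > 0" "s\<^sup>2 = q / p" using pq by (simp_all add: s_def)
    have "v \<le> C / 2 * (s\<^sup>2 * a + b / s\<^sup>2)" by (rule le[OF s(1)])
    also have "\<dots> \<le> C / 2 * (s\<^sup>2 * p\<^sup>2 + q\<^sup>2 / s\<^sup>2)"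
      using assms(1) s d pq by (intro mult_left_mono add_mono divide_right_mono) auto
    also have "\<dots> = C * p * q" using pq(1,2) unfolding s(2) by (simp add: power2_eq_square field_simps)
    finally show ?thesis by (simp add: p_def q_def)
  qed
  have "((\<lambda>d. C * sqrt (a + d) * sqrt (b + d)) \<longlongrightarrow> C * sqrt (a + 0) * sqrt (b + 0)) (at_right 0)"
    by (intro tendsto_intros)
  moreover have "eventually (\<lambda>d. v \<le> C * sqrt (a + d) * sqrt (b + d)) (at_right 0)"
    using * eventually_at_right_less[of "0::real"] by (auto elim: eventually_mono)
  ultimately have "v \<le> C * sqrt (a + 0) * sqrt (b + 0)"
    by (intro tendsto_lowerbound) auto
  then show ?thesis by simp
qed

text \<open>The defect of the desired inequality is affine in the quadruple, so the concave-like
  condition holds with equality at the convex combination; compactness and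
  \<open>average_bound\<close> provide the other inputs of the minimax theorem.\<close>

lemma exists_dominating_states:
  assumes u: "contbil u" and C: "C > 0"
    and hyp: "\<forall>m xs ys. (\<forall>j<m. xs j \<in> Sspace \<and> ys j \<in> Sspace) \<longrightarrow>
      cmod (\<Sum>j<m. u (xs j) (ys j)) \<le> C * rcnorm k m xs * rcnorm k m ys"
  shows "\<exists>\<phi>1\<in>closure (state_hull k). \<exists>\<phi>2\<in>closure (state_hull k).
    \<exists>\<psi>1\<in>closure (state_hull k). \<exists>\<psi>2\<in>closure (state_hull k). \<forall>x\<in>Sspace. \<forall>y\<in>Sspace.
      cmod (u x y) \<le> C / 2 * (Re (\<phi>1 (opmult (adj x) x)) + Re (\<phi>2 (opmult x (adj x)))
        + Re (\<psi>1 (opmult (adj y) y)) + Re (\<psi>2 (opmult y (adj y))))"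
proof -
  let ?S = "closure (state_hull k)"
  let ?X = "?S \<times> ?S \<times> ?S \<times> ?S"
  define f where "f p = (\<lambda>(\<phi>1, \<phi>2, \<psi>1, \<psi>2).
      C / 2 * (Re (\<phi>1 (opmult (adj (fst p)) (fst p))) + Re (\<phi>2 (opmult (fst p) (adj (fst p))))
        + Re (\<psi>1 (opmult (adj (snd p)) (snd p))) + Re (\<psi>2 (opmult (snd p) (adj (snd p)))))
      - cmod (u (fst p) (snd p)))"
    for p :: "op \<times> op"
  have "\<exists>X\<in>?X. \<forall>p\<in>Sspace \<times> Sspace. f p X \<ge> 0"
  proof (rule compact_concavelike_minimax)
    show "compact ?X" by (intro compact_Times compact_closure_state_hull)
    have "(\<lambda>x. if x \<in> Sspace then vstate (\<lambda>i. 0) x else 0) \<in> ?S"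
      using vstate_in_state_hull[OF zero_in_dball] closure_subset by blast
    then show "?X \<noteq> {}" by blast
    note coord = continuous_on_product_then_coordinatewise
    note id = continuous_on_id[of UNIV]
    show "continuous_on UNIV (f p)" for p
      unfolding f_def case_prod_unfold
      by (intro continuous_on_diff continuous_on_mult continuous_on_add continuous_on_const continuous_on_Re
          coord[OF continuous_on_fst[OF id]] coord[OF continuous_on_fst[OF continuous_on_snd[OF id]]]
          coord[OF continuous_on_fst[OF continuous_on_snd[OF continuous_on_snd[OF id]]]]
          coord[OF continuous_on_snd[OF continuous_on_snd[OF continuous_on_snd[OF id]]]])
  next
    fix X Y t assume X: "X \<in> ?X" and Y: "Y \<in> ?X" and t: "0 \<le> t" "t \<le> (1::real)"
    obtain a b c d where Xe: "X = (a, b, c, d)" by (cases X)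
    obtain a' b' c' d' where Ye: "Y = (a', b', c', d')" by (cases Y)
    let ?m = "\<lambda>(\<phi>::op \<Rightarrow> complex) \<psi> x. complex_of_real (1 - t) * \<phi> x + complex_of_real t * \<psi> x"
    let ?Z = "(?m a a', ?m b b', ?m c c', ?m d d')"
    have "?Z \<in> ?X"
      using X Y unfolding Xe Ye by (auto intro!: closure_state_hull_convex t simp del: of_real_diff)
    moreover have "(1 - t) * f p X + t * f p Y \<le> f p ?Z" for p
      unfolding Xe Ye f_def by (simp add: algebra_simps add_divide_distrib diff_divide_distrib)
    ultimately show "\<exists>Z\<in>?X. \<forall>p\<in>Sspace \<times> Sspace. (1 - t) * f p X + t * f p Y \<le> f p Z" by blast
  next
    fix J :: "(op \<times> op) set" and l :: "op \<times> op \<Rightarrow> real" and e :: real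
    assume J: "finite J" "J \<subseteq> Sspace \<times> Sspace" and l: "\<And>p. p \<in> J \<Longrightarrow> 0 \<le> l p" and "sum l J = 1" and e: "0 < e"
    obtain \<xi>1 \<xi>2 \<eta>1 \<eta>2 where d: "\<xi>1 \<in> dball k" "\<xi>2 \<in> dball k" "\<eta>1 \<in> dball k" "\<eta>2 \<in> dball k"
      and g: "(\<Sum>p\<in>J. l p * (C / 2 * (Re (vstate \<xi>1 (opmult (adj (fst p)) (fst p))) + Re (vstate \<xi>2 (opmult (fst p) (adj (fst p))))
      + Re (vstate \<eta>1 (opmult (adj (snd p)) (snd p))) + Re (vstate \<eta>2 (opmult (snd p) (adj (snd p)))))
      - cmod (u (fst p) (snd p)))) > - e"
      using average_bound[OF u C hyp J _ e] l by blast
    let ?v = "\<lambda>\<xi> x. if x \<in> Sspace then vstate \<xi> x else 0"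
    have v: "?v \<xi> \<in> ?S" if "\<xi> \<in> dball k" for \<xi>
      using vstate_in_state_hull[OF that] closure_subset by blast
    have "(\<Sum>p\<in>J. l p * f p (?v \<xi>1, ?v \<xi>2, ?v \<eta>1, ?v \<eta>2)) = (\<Sum>p\<in>J. l p * (C / 2 * (Re (vstate \<xi>1 (opmult (adj (fst p)) (fst p))) + Re (vstate \<xi>2 (opmult (fst p) (adj (fst p))))
      + Re (vstate \<eta>1 (opmult (adj (snd p)) (snd p))) + Re (vstate \<eta>2 (opmult (snd p) (adj (snd p)))))
      - cmod (u (fst p) (snd p))))"
    proof (rule sum.cong[OF refl])
      fix p assume "p \<in> J"
      then have "fst p \<in> Sspace" "snd p \<in> Sspace" using J(2) by auto
      then show "l p * f p (?v \<xi>1, ?v \<xi>2, ?v \<eta>1, ?v \<eta>2) = l p * (C / 2 * (Re (vstate \<xi>1 (opmult (adj (fst p)) (fst p))) + Re (vstate \<xi>2 (opmult (fst p) (adj (fst p))))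
      + Re (vstate \<eta>1 (opmult (adj (snd p)) (snd p))) + Re (vstate \<eta>2 (opmult (snd p) (adj (snd p)))))
      - cmod (u (fst p) (snd p)))"
        by (simp add: f_def adj_mult_in_Sspace mult_adj_in_Sspace)
    qed
    with g v[OF d(1)] v[OF d(2)] v[OF d(3)] v[OF d(4)]
    show "\<exists>X\<in>?X. - e < (\<Sum>p\<in>J. l p * f p X)"
      by (intro bexI[of _ "(?v \<xi>1, ?v \<xi>2, ?v \<eta>1, ?v \<eta>2)"]) auto
  qed
  then obtain \<phi>1 \<phi>2 \<psi>1 \<psi>2 where S: "\<phi>1 \<in> ?S" "\<phi>2 \<in> ?S" "\<psi>1 \<in> ?S" "\<psi>2 \<in> ?S"
    and le: "\<And>p. p \<in> Sspace \<times> Sspace \<Longrightarrow> f p (\<phi>1, \<phi>2, \<psi>1, \<psi>2) \<ge> 0"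
    by blast
  have "\<forall>x\<in>Sspace. \<forall>y\<in>Sspace.
      cmod (u x y) \<le> C / 2 * (Re (\<phi>1 (opmult (adj x) x)) + Re (\<phi>2 (opmult x (adj x)))
        + Re (\<psi>1 (opmult (adj y) y)) + Re (\<psi>2 (opmult y (adj y))))"
  proof (intro ballI)
    fix x y assume "x \<in> Sspace" "y \<in> Sspace"
    then show "cmod (u x y) \<le> C / 2 * (Re (\<phi>1 (opmult (adj x) x)) + Re (\<phi>2 (opmult x (adj x)))
        + Re (\<psi>1 (opmult (adj y) y)) + Re (\<psi>2 (opmult y (adj y))))"
      using le[of "(x, y)"] by (simp add: f_def)
  qed
  with S show ?thesis by blast
qed

lemma Sdual_scale:
  assumes "\<phi> \<in> Sdual" "x \<in> Sspace"
  shows "\<phi> (\<lambda>\<xi> i. a * x \<xi> i) = a * \<phi> x"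
proof -
  have "\<phi> (\<lambda>\<xi> i. a * x \<xi> i + 0 * x \<xi> i) = a * \<phi> x + 0 * \<phi> x"
    using assms unfolding Sdual_def by blast
  then show ?thesis by simp
qed

lemma exists_factorizing_states:
  assumes u: "contbil u" and C: "C > 0"
    and hyp: "\<forall>m xs ys. (\<forall>j<m. xs j \<in> Sspace \<and> ys j \<in> Sspace) \<longrightarrow>
      cmod (\<Sum>j<m. u (xs j) (ys j)) \<le> C * rcnorm k m xs * rcnorm k m ys"
  shows "\<exists>\<phi>1 \<phi>2 \<psi>1 \<psi>2. nstate k \<phi>1 \<and> nstate k \<phi>2 \<and> nstate k \<psi>1 \<and> nstate k \<psi>2 \<and>
    (\<forall>x\<in>Sspace. \<forall>y\<in>Sspace. cmod (u x y) \<le> C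
      * sqrt (Re (\<phi>1 (opmult (adj x) x) + \<phi>2 (opmult x (adj x))))
      * sqrt (Re (\<psi>1 (opmult (adj y) y) + \<psi>2 (opmult y (adj y)))))"
proof -
  obtain \<phi>1 \<phi>2 \<psi>1 \<psi>2 where S: "\<phi>1 \<in> closure (state_hull k)" "\<phi>2 \<in> closure (state_hull k)"
      "\<psi>1 \<in> closure (state_hull k)" "\<psi>2 \<in> closure (state_hull k)"
    and le: "\<And>x y. x \<in> Sspace \<Longrightarrow> y \<in> Sspace \<Longrightarrow>
      cmod (u x y) \<le> C / 2 * (Re (\<phi>1 (opmult (adj x) x)) + Re (\<phi>2 (opmult x (adj x)))
        + Re (\<psi>1 (opmult (adj y) y)) + Re (\<psi>2 (opmult y (adj y))))"
    using exists_dominating_states[OF u C hyp] by blast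
  have scale: "Re (\<phi> (opmult (adj (\<lambda>\<xi> i. complex_of_real s * x \<xi> i)) (\<lambda>\<xi> i. complex_of_real s * x \<xi> i)))
        = s\<^sup>2 * Re (\<phi> (opmult (adj x) x))"
      "Re (\<phi> (opmult (\<lambda>\<xi> i. complex_of_real s * x \<xi> i) (adj (\<lambda>\<xi> i. complex_of_real s * x \<xi> i))))
        = s\<^sup>2 * Re (\<phi> (opmult x (adj x)))"
    and nonneg: "0 \<le> Re (\<phi> (opmult (adj x) x))" "0 \<le> Re (\<phi> (opmult x (adj x)))"
    if \<phi>: "\<phi> \<in> closure (state_hull k)" and x: "x \<in> Sspace" for \<phi> s x
  proof -
    have "\<And>\<xi>. \<xi> \<in> dball k \<Longrightarrow> \<xi> \<in> sdual" using dball_subset_sdual by blast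
    then show "0 \<le> Re (\<phi> (opmult (adj x) x))" "0 \<le> Re (\<phi> (opmult x (adj x)))"
      using x by (auto intro!: closure_state_hull_nonneg[OF \<phi>] adj_mult_in_Sspace mult_adj_in_Sspace
          Re_vstate_adj_mult_nonneg Re_vstate_mult_adj_nonneg)
    note d = closure_state_hull_in_Sdual[OF \<phi>]
    show "Re (\<phi> (opmult (adj (\<lambda>\<xi> i. complex_of_real s * x \<xi> i)) (\<lambda>\<xi> i. complex_of_real s * x \<xi> i)))
        = s\<^sup>2 * Re (\<phi> (opmult (adj x) x))"
      unfolding adj_mult_scale[OF x] Sdual_scale[OF d adj_mult_in_Sspace[OF x]] by (simp del: of_real_power)
    show "Re (\<phi> (opmult (\<lambda>\<xi> i. complex_of_real s * x \<xi> i) (adj (\<lambda>\<xi> i. complex_of_real s * x \<xi> i))))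
        = s\<^sup>2 * Re (\<phi> (opmult x (adj x)))"
      unfolding mult_adj_scale[OF x] Sdual_scale[OF d mult_adj_in_Sspace[OF x]] by (simp del: of_real_power)
  qed
  have "cmod (u x y) \<le> C
      * sqrt (Re (\<phi>1 (opmult (adj x) x) + \<phi>2 (opmult x (adj x))))
      * sqrt (Re (\<psi>1 (opmult (adj y) y) + \<psi>2 (opmult y (adj y))))"
    if x: "x \<in> Sspace" and y: "y \<in> Sspace" for x y
  proof (rule le_sqrt_mult_sqrt)
    fix s :: real assume s: "s > 0"
    let ?x = "\<lambda>\<xi> i. complex_of_real s * x \<xi> i" and ?y = "\<lambda>\<xi> i. complex_of_real (1 / s) * y \<xi> i"
    have "u ?x ?y = u x y"
      unfolding contbil_scale[OF u x y] of_real_mult[symmetric] using s by simp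
    then show "cmod (u x y) \<le> C / 2 * (s\<^sup>2 * Re (\<phi>1 (opmult (adj x) x) + \<phi>2 (opmult x (adj x)))
        + Re (\<psi>1 (opmult (adj y) y) + \<psi>2 (opmult y (adj y))) / s\<^sup>2)"
      using le[OF Sspace_scale_closed[OF x, of "complex_of_real s"] Sspace_scale_closed[OF y, of "complex_of_real (1 / s)"]]
      unfolding scale(1)[OF S(1) x] scale(2)[OF S(2) x] scale(1)[OF S(3) y] scale(2)[OF S(4) y]
      by (simp add: distrib_left add_divide_distrib power_divide)
  qed (use C nonneg S x y in auto)
  with S show ?thesis using closure_state_hull_nstate by blast
qed

section \<open>The norm of a bilinear form and the positivity of the constant\<close>

lemma bilnorm_upper:
  assumes "x \<in> Sspace" "y \<in> Sspace" "opnorm n x \<le> 1" "opnorm n y \<le> 1"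
  shows "ereal (cmod (u x y)) \<le> bilnorm n u"
  unfolding bilnorm_def using assms by (intro SUP_upper2[of "(x, y)"]) auto

lemma bilnorm_nonneg: "0 \<le> bilnorm n u"
proof -
  have "0 \<le> ereal (cmod (u (\<lambda>\<xi> i. 0) (\<lambda>\<xi> i. 0)))" by simp
  also have "\<dots> \<le> bilnorm n u"
    by (rule bilnorm_upper) (simp_all add: zero_in_Sspace opnorm_zero)
  finally show ?thesis .
qed

text \<open>Every operator has a positive multiple in the n-th unit ball, so vanishing on the balls
  propagates to all of \<open>Sspace\<close> by bilinearity.\<close>

lemma bilnorm_zero_imp:
  assumes u: "contbil u" and B: "bilnorm n u = 0" and x: "x \<in> Sspace" and y: "y \<in> Sspace"
  shows "u x y = 0"
proof -
  have n: "\<exists>a>0. opnorm n (\<lambda>\<xi> i. complex_of_real a * x \<xi> i) \<le> 1" if x: "x \<in> Sspace" for x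
  proof (intro exI conjI)
    have o: "opnorm n x \<ge> 0" by (rule opnorm_nonneg[OF x])
    show "1 / (opnorm n x + 1) > 0" using o by simp
    have "opnorm n (\<lambda>\<xi> i. complex_of_real (1 / (opnorm n x + 1)) * x \<xi> i)
        \<le> cmod (complex_of_real (1 / (opnorm n x + 1))) * opnorm n x"
      by (rule opnorm_scale_le[OF x])
    also have "\<dots> \<le> 1" unfolding norm_of_real using o by simp
    finally show "opnorm n (\<lambda>\<xi> i. complex_of_real (1 / (opnorm n x + 1)) * x \<xi> i) \<le> 1" .
  qed
  obtain a b where ab: "a > 0" "opnorm n (\<lambda>\<xi> i. complex_of_real a * x \<xi> i) \<le> 1"
    "b > 0" "opnorm n (\<lambda>\<xi> i. complex_of_real b * y \<xi> i) \<le> 1"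
    using n[OF x] n[OF y] by blast
  have "ereal (cmod (u (\<lambda>\<xi> i. complex_of_real a * x \<xi> i) (\<lambda>\<xi> i. complex_of_real b * y \<xi> i))) \<le> 0"
    unfolding B[symmetric] by (intro bilnorm_upper Sspace_scale_closed x y ab)
  then show ?thesis using ab by (simp add: contbil_scale[OF u x y])
qed

lemma Kn_le_Kconst: "n \<ge> 1 \<Longrightarrow> Kn n \<le> Kconst"
  unfolding Kconst_def by (intro SUP_upper) auto

text \<open>The first diagonal matrix unit. The first coordinate has weight one at every index, so
  the same bound serves all norms.\<close>

lemma rank_one_in_Sspace: "(\<lambda>\<xi>. if \<xi> \<in> sdual then (\<lambda>i. \<xi> 0 * unitv 0 i) else (\<lambda>i. 0)) \<in> Sspace"
proof (rule SspaceI[where c="\<lambda>n. 1"])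
  fix n \<xi> assume \<xi>: "\<xi> \<in> dball n"
  then have s: "\<xi> \<in> sdual" "summable (\<lambda>i. (cmod (\<xi> i))\<^sup>2 / real (Suc i) ^ (2*n))" "sdnorm n \<xi> \<le> 1"
    using dball_subset_sdual by (auto simp: dball_def)
  have "(cmod (\<xi> 0))\<^sup>2 \<le> (\<Sum>i. (cmod (\<xi> i))\<^sup>2 / real (Suc i) ^ (2*n))"
    using sum_le_suminf[OF s(2), of "{0}"] by simp
  also have "\<dots> \<le> 1" using s(3) unfolding sdnorm_def by simp
  finally have "cmod (\<xi> 0) \<le> 1" using power2_le_imp_le[of "cmod (\<xi> 0)" 1] by simp
  moreover have "(\<Sum>i. (cmod (unitv 0 i))\<^sup>2 * real (Suc i) ^ (2 * n)) = 1"
    by (subst suminf_finite[of "{0}"]) (auto simp: unitv_def)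
  then have "snorm n (unitv 0) = 1" by (simp add: snorm_def)
  ultimately show "snorm n (if \<xi> \<in> sdual then (\<lambda>i. \<xi> 0 * unitv 0 i) else (\<lambda>i. 0)) \<le> 1"
    using s(1) by (simp add: snorm_scale[OF unitv_in_sspace])
qed (simp_all add: sdual_lincomb sspace_scale unitv_in_sspace algebra_simps)

lemma opnorm_coeff_bound:
  assumes x: "x \<in> Sspace"
  shows "cmod (x (unitv 0) 0) \<le> opnorm n x"
proof -
  have "(\<Sum>i. (cmod (unitv 0 i))\<^sup>2 / real (Suc i) ^ (2 * n)) = 1"
    by (subst suminf_finite[of "{0}"]) (auto simp: unitv_def)
  moreover have "unitv 0 \<in> sdualn n" using sspace_subset_sdualn unitv_in_sspace by blast
  ultimately have e: "unitv 0 \<in> dball n" by (simp add: dball_alt sdnorm_def)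
  have sm: "summable (\<lambda>i. (cmod (x (unitv 0) i))\<^sup>2 * real (Suc i) ^ (2*n))"
    using Sspace_sspace[OF x] unfolding sspace_def by blast
  have "(cmod (x (unitv 0) 0))\<^sup>2 \<le> (\<Sum>i. (cmod (x (unitv 0) i))\<^sup>2 * real (Suc i) ^ (2*n))"
    using sum_le_suminf[OF sm, of "{0}"] by simp
  then have "cmod (x (unitv 0) 0) \<le> snorm n (x (unitv 0))"
    unfolding snorm_def by (rule real_le_rsqrt)
  also have "\<dots> \<le> opnorm n x" by (rule opnorm_upper[OF x e])
  finally show ?thesis .
qed

text \<open>Tests the defining inequality on a single pair: the product of the corner coefficients,
  evaluated at the corner matrix unit \<open>E\<close>, is 1, so an admissible \<open>C\<close>
  satisfies \<open>1 \<le> C * (r * r)\<close>.\<close>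

lemma Kn_pos: "0 < Kn n"
proof -
  define u where "u x y = x (unitv 0) 0 * y (unitv 0) 0" for x y :: op
  define E where "E = (\<lambda>\<xi>. if \<xi> \<in> sdual then (\<lambda>i. \<xi> 0 * unitv 0 i) else (\<lambda>i. 0))"
  define r where "r = rcnorm (2*n+1) 1 (\<lambda>j. E)"
  have E: "E \<in> Sspace" unfolding E_def by (rule rank_one_in_Sspace)
  have r: "0 \<le> r" unfolding r_def using E by (intro rcnorm_power2(2))
  have b: "cmod (u x y) \<le> opnorm m x * opnorm m y" if "x \<in> Sspace" "y \<in> Sspace" for m x y
    unfolding u_def norm_mult by (intro mult_mono opnorm_coeff_bound opnorm_nonneg that) auto
  have u: "contbil u"
    unfolding contbil_def
  proof (intro conjI ballI allI)
    show "\<exists>n C. \<forall>x\<in>Sspace. \<forall>y\<in>Sspace. cmod (u x y) \<le> C * opnorm n x * opnorm n y"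
      using b by (intro exI[of _ 0] exI[of _ 1]) simp
  qed (simp_all add: u_def algebra_simps)
  have B: "bilnorm n u \<le> 1"
    unfolding bilnorm_def
  proof (rule SUP_least, clarify)
    fix x y assume xy: "x \<in> Sspace" "y \<in> Sspace" "opnorm n x \<le> 1" "opnorm n y \<le> 1"
    then have "opnorm n x * opnorm n y \<le> 1"
      using opnorm_nonneg by (metis mult_le_one)
    then show "ereal (cmod (u x y)) \<le> 1" using b[OF xy(1,2), of n] by simp
  qed
  have one: "u E E = 1" by (simp add: u_def E_def unitv_in_sdual) (simp add: unitv_def)
  \<comment> \<open>The value of \<open>r\<close> is left uncomputed; adding one gives a positive
    denominator without a lower bound on \<open>r\<close>.\<close>
  have "ereal (1 / (r * r + 1)) \<le> Kn n"
    unfolding Kn_def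
  proof (rule Inf_greatest, clarify)
    fix C :: ereal assume C: "0 \<le> C" and all: "\<forall>u m xs ys. contbil u \<and> (\<forall>j<m. xs j \<in> Sspace \<and> ys j \<in> Sspace) \<longrightarrow>
          ereal (cmod (\<Sum>j<m. u (xs j) (ys j)))
            \<le> C * bilnorm n u * ereal (rcnorm (2*n+1) m xs) * ereal (rcnorm (2*n+1) m ys)"
    have "ereal (cmod (\<Sum>j<1::nat. u E E)) \<le> C * bilnorm n u * ereal r * ereal r"
      unfolding r_def using all[rule_format, of u 1 "\<lambda>_. E" "\<lambda>_. E"] u E by simp
    then have "1 \<le> C * bilnorm n u * ereal r * ereal r" by (simp add: one one_ereal_def)
    also have "\<dots> \<le> C * 1 * ereal r * ereal r"
      using B C r by (intro ereal_mult_right_mono ereal_mult_left_mono) auto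
    finally have "1 \<le> C * ereal (r * r)" by (simp add: mult.assoc)
    then show "ereal (1 / (r * r + 1)) \<le> C"
    proof (cases C)
      case (real c)
      then have "c \<ge> 0" "1 \<le> c * (r * r)" using C \<open>1 \<le> C * ereal (r * r)\<close> by (simp_all add: one_ereal_def)
      then have "1 \<le> c * (r * r + 1)" by (simp add: distrib_left)
      moreover have "r * r + 1 > 0" using r by (simp add: add_nonneg_pos)
      ultimately show ?thesis using real by (simp add: pos_divide_le_eq)
    qed (use C in auto)
  qed
  moreover have "0 < ereal (1 / (r * r + 1))" using r by (simp add: add_nonneg_pos)
  ultimately show ?thesis by (rule less_le_trans[rotated])
qed

text \<open>Passes from the extended-real infimum to a real inequality: an admissible constant is
  chosen within \<open>e / (M + 1)\<close> above \<open>c\<close>, which costs at most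
  \<open>e\<close>.\<close>

lemma Kn_bound:
  assumes u: "contbil u" and K: "Kn n \<le> ereal c" and B: "bilnorm n u = ereal b"
    and S: "\<forall>j<m. xs j \<in> Sspace \<and> ys j \<in> Sspace"
  shows "cmod (\<Sum>j<m. u (xs j) (ys j)) \<le> (c * b) * rcnorm (2*n+1) m xs * rcnorm (2*n+1) m ys"
proof -
  define M where "M = b * rcnorm (2*n+1) m xs * rcnorm (2*n+1) m ys"
  have "b \<ge> 0" using bilnorm_nonneg[of n u] B by simp
  then have M: "M \<ge> 0" unfolding M_def using S by (simp add: rcnorm_power2(2))
  have "cmod (\<Sum>j<m. u (xs j) (ys j)) \<le> c * M"
  proof (rule field_le_epsilon)
    fix e :: real assume e: "e > 0"
    have "Kn n < ereal (c + e / (M + 1))"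
      using K e M by (intro le_less_trans[OF K]) simp
    then obtain C where C: "C < ereal (c + e / (M + 1))" "C \<ge> 0"
      and all: "\<forall>u m xs ys. contbil u \<and> (\<forall>j<m. xs j \<in> Sspace \<and> ys j \<in> Sspace) \<longrightarrow>
          ereal (cmod (\<Sum>j<m. u (xs j) (ys j)))
            \<le> C * bilnorm n u * ereal (rcnorm (2*n+1) m xs) * ereal (rcnorm (2*n+1) m ys)"
      unfolding Kn_def Inf_less_iff by blast
    obtain C' where C': "C = ereal C'" using C by (cases C) auto
    have "ereal (cmod (\<Sum>j<m. u (xs j) (ys j)))
        \<le> C * bilnorm n u * ereal (rcnorm (2*n+1) m xs) * ereal (rcnorm (2*n+1) m ys)"
      using all u S by blast
    then have "cmod (\<Sum>j<m. u (xs j) (ys j)) \<le> C' * M"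
      by (simp add: B C' M_def mult.assoc)
    also have "\<dots> \<le> (c + e / (M + 1)) * M" using C(1) M by (intro mult_right_mono) (auto simp: C')
    also have "\<dots> \<le> c * M + e"
    proof -
      have "M / (M + 1) \<le> 1" using M by simp
      from mult_right_mono[OF this, of e] show ?thesis using e by (simp add: algebra_simps)
    qed
    finally show "cmod (\<Sum>j<m. u (xs j) (ys j)) \<le> c * M + e" .
  qed
  then show ?thesis by (simp add: M_def mult.assoc)
qed

theorem theorem4p1:
  fixes u :: "op \<Rightarrow> op \<Rightarrow> complex" and n :: nat
  assumes "contbil u" and "n \<ge> 1"
  shows "\<exists>\<phi>1 \<phi>2 \<psi>1 \<psi>2.
           nstate (2*n+1) \<phi>1 \<and> nstate (2*n+1) \<phi>2 \<and> nstate (2*n+1) \<psi>1 \<and> nstate (2*n+1) \<psi>2 \<and>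
           (\<forall>x\<in>Sspace. \<forall>y\<in>Sspace.
              ereal (cmod (u x y))
                \<le> Kconst * bilnorm n u
                   * ereal (sqrt (Re (\<phi>1 (opmult (adj x) x) + \<phi>2 (opmult x (adj x)))))
                   * ereal (sqrt (Re (\<psi>1 (opmult (adj y) y) + \<psi>2 (opmult y (adj y))))))"
proof -
  let ?k = "2*n+1"
  have K: "0 < Kconst" by (rule less_le_trans[OF Kn_pos Kn_le_Kconst[OF assms(2)]])
  note B = bilnorm_nonneg[of n u]
  show ?thesis
  proof (cases "bilnorm n u = 0 \<or> Kconst = \<infinity> \<or> bilnorm n u = \<infinity>")
    case True
    \<comment> \<open>One choice of states covers all degenerate cases. If
      \<open>bilnorm n u\<close> is zero, then \<open>u\<close> vanishes on \<open>Sspace\<close>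
      and both sides are zero.\<close>
    let ?f = "faithful_state ?k"
    let ?q = "\<lambda>x. sqrt (Re (?f (opmult (adj x) x) + ?f (opmult x (adj x))))"
    have q0: "0 \<le> ?q x" if "x \<in> Sspace" for x
      using that dball_subset_sdual
      by (auto intro!: add_nonneg_nonneg Re_faithful_state_nonneg adj_mult_in_Sspace mult_adj_in_Sspace
          Re_vstate_adj_mult_nonneg Re_vstate_mult_adj_nonneg)
    have q: "0 < ?q x" if x: "x \<in> Sspace" "x \<noteq> (\<lambda>\<xi> i. 0)" for x
    proof -
      have "0 \<le> Re (?f (opmult x (adj x)))"
        using x(1) dball_subset_sdual
        by (intro Re_faithful_state_nonneg mult_adj_in_Sspace Re_vstate_mult_adj_nonneg) auto
      then show ?thesis using Re_faithful_state_adj_mult_pos[OF x, of ?k] by simp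
    qed
    have "ereal (cmod (u x y)) \<le> Kconst * bilnorm n u * ereal (?q x) * ereal (?q y)"
      if x: "x \<in> Sspace" and y: "y \<in> Sspace" for x y
    proof (cases "bilnorm n u = 0")
      case True
      then show ?thesis using bilnorm_zero_imp[OF assms(1) True x y] by simp
    next
      case nz: False
      \<comment> \<open>Both factors are strictly positive here, so an infinite factor is not
        cancelled by a zero one.\<close>
      then have inf: "Kconst * bilnorm n u = \<infinity>" using True K B by (auto simp: ereal_mult_eq_PInfty)
      show ?thesis
      proof (cases "x = (\<lambda>\<xi> i. 0) \<or> y = (\<lambda>\<xi> i. 0)")
        case True
        then have "u x y = 0"
          using contbil_scale[OF assms(1) x y, of 0 1] contbil_scale[OF assms(1) x y, of 1 0] by auto
        moreover have "0 \<le> Kconst * bilnorm n u * ereal (?q x) * ereal (?q y)"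
          using K B q0[OF x] q0[OF y] by (intro ereal_0_le_mult) auto
        ultimately show ?thesis by (simp only: norm_zero zero_ereal_def)
      next
        case False
        then show ?thesis using q[OF x] q[OF y] by (simp add: inf)
      qed
    qed
    then show ?thesis using nstate_faithful_state[of ?k] by blast
  next
    case False
    obtain c where c: "Kconst = ereal c" using False K by (cases Kconst) auto
    obtain b where b: "bilnorm n u = ereal b" using False B by (cases "bilnorm n u") auto
    have "c * b > 0" using K B False unfolding c b by auto
    moreover have "Kn n \<le> ereal c" using Kn_le_Kconst[OF assms(2)] c by simp
    ultimately obtain \<phi>1 \<phi>2 \<psi>1 \<psi>2 where s: "nstate ?k \<phi>1" "nstate ?k \<phi>2" "nstate ?k \<psi>1" "nstate ?k \<psi>2"
      and le: "\<forall>x\<in>Sspace. \<forall>y\<in>Sspace. cmod (u x y) \<le> (c * b)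
      * sqrt (Re (\<phi>1 (opmult (adj x) x) + \<phi>2 (opmult x (adj x))))
      * sqrt (Re (\<psi>1 (opmult (adj y) y) + \<psi>2 (opmult y (adj y))))"
      using exists_factorizing_states[OF assms(1), of "c * b" ?k] Kn_bound[OF assms(1) _ b] by blast
    show ?thesis unfolding c b using s le
      by (intro exI[of _ \<phi>1] exI[of _ \<phi>2] exI[of _ \<psi>1] exI[of _ \<psi>2]) simp
  qed
qed

end
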